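(* Let $f:\mathbb{C}\to\widehat{\mathbb{C}}$ be a topologically hyperbolic meromorphic map and let $U$ be a Fatou component of $f$. Denote by $U_n$ the Fatou component of $f$ such that $f^n(U)\subset U_n$, and suppose that $U_n\cap P(f)=\emptyset$ for $n>0$. Then for every compact set $K\subset U$, every $z\in K$ and every $r>0$ there exists $n_0$ such that for all $n\ge n_0$ $$\mathbb{D}(f^n(z),r)\subset U_n.$$ In particular, $$\operatorname{diam}U_n\to\infty\quad\text{and}\quad\operatorname{dist}(f^n(z),\partial U_n)\to\infty$$ for every $z\in U$, as $n\to\infty$.
   Context: $\widehat{\mathbb{C}}$ is the Riemann sphere. $\operatorname{dist}$ and $\operatorname{diam}$ are Euclidean distance and diameter, $\mathbb{D}(w,r)=\{v\in\mathbb{C}:|v-w|<r\}$, and $\partial U_n$ is the boundary in $\mathbb{C}$. For a meromorphic map $f:\mathbb{C}\to\widehat{\mathbb{C}}$, the Fatou set $F(f)$ is the set of points having a neighborhood on which all iterates $f^n$, $n>0$, are well defined and form a normal family; the Julia set is $J(f)=\widehat{\mathbb{C}}\setminus F(f)$. A Fatou component is a connected component of $F(f)$. $S(f)\subset\mathbb{C}$ is the set of finite singular values of $f$, i.e. finite critical values and finite asymptotic values. The postsingular set is $$P(f)=\mathbb{C}\cap\bigcup_{s\in\overline{S(f)}}\bigcup_{n=0}^\infty f^n(s),$$ where terms that are undefined or infinite are neglected. A transcendental meromorphic function $f$ (i.e. one with an essential singularity at $\infty$) is called topologically hyperbolic if $\operatorname{dist}(P(f),J(f)\cap\mathbb{C})>0$.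 *)

theory Defs
  imports "HOL-Complex_Analysis.Complex_Analysis"
begin

text \<open>
  A meromorphic map from the plane to the Riemann sphere (not constantly infinity) is represented
  by a total function \<open>f :: complex \<Rightarrow> complex\<close> with \<open>f nicely_meromorphic_on UNIV\<close>: it is
  holomorphic off its poles, the sphere-valued map is infinity exactly where \<open>is_pole f\<close> holds,
  and the value \<open>f z = 0\<close> at a pole is a dummy.  Points of the Riemann sphere are elements of
  \<open>complex option\<close>, with \<open>None\<close> standing for infinity.
\<close>

type_synonym sphere = "complex option"

text \<open>
  Stereographic projection onto the unit sphere of \<open>complex \<times> real\<close>; the Euclidean distance
  there is the chordal metric.
\<close>

definition stereo :: "sphere \<Rightarrow> complex \<times> real" where
  "stereo p = (case p of
      None \<Rightarrow> (0, 1)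
    | Some z \<Rightarrow> (2 * z / of_real (1 + (norm z)\<^sup>2), ((norm z)\<^sup>2 - 1) / ((norm z)\<^sup>2 + 1)))"

text \<open>Limit functions may take the value infinity, as usual for meromorphic functions.\<close>

definition normal_family_on :: "complex set \<Rightarrow> (complex \<Rightarrow> sphere) set \<Rightarrow> bool" where
  "normal_family_on V F \<longleftrightarrow>
     (\<forall>s :: nat \<Rightarrow> complex \<Rightarrow> sphere. range s \<subseteq> F \<longrightarrow>
        (\<exists>(k :: nat \<Rightarrow> nat) (g :: complex \<Rightarrow> sphere). strict_mono k \<and>
           (\<forall>K. compact K \<and> K \<subseteq> V \<longrightarrow>
              uniform_limit K (\<lambda>j z. stereo (s (k j) z)) (\<lambda>z. stereo (g z)) sequentially)))"

text \<open>
  Since \<open>f\<close> is not defined at infinity, the \<open>n\<close>-th iterate at \<open>z\<close> is defined, with a value in the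
  sphere, iff all earlier iterates are finite.  While the orbit has not met a pole, the
  library iterate \<open>(f ^^ n) z\<close> is the true one.
\<close>

definition iterate_finite :: "(complex \<Rightarrow> complex) \<Rightarrow> nat \<Rightarrow> complex \<Rightarrow> bool" where
  "iterate_finite f n z \<longleftrightarrow> (\<forall>k<n. \<not> is_pole f ((f ^^ k) z))"

definition iterate_defined :: "(complex \<Rightarrow> complex) \<Rightarrow> nat \<Rightarrow> complex \<Rightarrow> bool" where
  "iterate_defined f n z \<longleftrightarrow> (\<forall>k<n. iterate_finite f k z)"

text \<open>Meaningful only where \<^const>\<open>iterate_defined\<close> holds.\<close>

definition sphere_iterate :: "(complex \<Rightarrow> complex) \<Rightarrow> nat \<Rightarrow> complex \<Rightarrow> sphere" where
  "sphere_iterate f n z = (if iterate_finite f n z then Some ((f ^^ n) z) else None)"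

text \<open>
  No neighbourhood of infinity qualifies, because \<open>f\<close> itself is undefined at infinity.  So the
  Fatou set is a subset of the plane, infinity belongs to the Julia set, and \<open>finite_julia_set\<close>
  is the part of the Julia set in the plane.
\<close>

definition fatou_set :: "(complex \<Rightarrow> complex) \<Rightarrow> complex set" where
  "fatou_set f = {z. \<exists>V. open V \<and> z \<in> V \<and>
     (\<forall>n>0. \<forall>w\<in>V. iterate_defined f n w) \<and>
     normal_family_on V {sphere_iterate f n | n. n > 0}}"

definition finite_julia_set :: "(complex \<Rightarrow> complex) \<Rightarrow> complex set" where
  "finite_julia_set f = - fatou_set f"

text \<open>Multiple poles are critical points too, but their critical value is infinity.\<close>

definition critical_values :: "(complex \<Rightarrow> complex) \<Rightarrow> complex set" where
  "critical_values f = {f z | z. \<not> is_pole f z \<and> deriv f z = 0}"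

definition asymptotic_values :: "(complex \<Rightarrow> complex) \<Rightarrow> complex set" where
  "asymptotic_values f = {a. \<exists>\<gamma> :: real \<Rightarrow> complex.
     continuous_on {0..} \<gamma> \<and> filterlim \<gamma> at_infinity at_top \<and>
     (\<forall>\<^sub>F t in at_top. \<not> is_pole f (\<gamma> t)) \<and> ((\<lambda>t. f (\<gamma> t)) \<longlongrightarrow> a) at_top}"

definition singular_values :: "(complex \<Rightarrow> complex) \<Rightarrow> complex set" where
  "singular_values f = critical_values f \<union> asymptotic_values f"

definition postsingular_set :: "(complex \<Rightarrow> complex) \<Rightarrow> complex set" where
  "postsingular_set f =
     {(f ^^ n) s | n s. s \<in> closure (singular_values f) \<and> iterate_finite f n s}"

text \<open>
  The second conjunct says that \<open>f\<close> has an essential singularity at infinity.  Poles may accumulate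
  there; the condition then still says that \<open>f\<close> has no limit in the sphere at infinity.
\<close>

definition transcendental_meromorphic :: "(complex \<Rightarrow> complex) \<Rightarrow> bool" where
  "transcendental_meromorphic f \<longleftrightarrow>
     f nicely_meromorphic_on UNIV \<and> \<not> not_essential (\<lambda>w. f (1 / w)) 0"

text \<open>
  \<^const>\<open>setdist\<close> is 0 if one of the sets is empty, but for transcendental \<open>f\<close> neither set is:
  the Julia set meets the plane, and without finite singular values \<open>f\<close> would restrict to a
  covering of the plane by the complement of its poles, hence be affine.
\<close>

definition topologically_hyperbolic :: "(complex \<Rightarrow> complex) \<Rightarrow> bool" where
  "topologically_hyperbolic f \<longleftrightarrow>
     transcendental_meromorphic f \<and> setdist (postsingular_set f) (finite_julia_set f) > 0"

definition fatou_component :: "(complex \<Rightarrow> complex) \<Rightarrow> complex set \<Rightarrow> bool" where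
  "fatou_component f U \<longleftrightarrow> U \<in> components (fatou_set f)"

text \<open>Unlike \<^const>\<open>diameter\<close>, this is infinity for unbounded sets.\<close>

definition ediameter :: "'a::metric_space set \<Rightarrow> ennreal" where
  "ediameter S = (SUP x\<in>S. SUP y\<in>S. ennreal (dist x y))"

end

theory Submission
  imports Defs
begin

text \<open>
  Suppose that discs of radius \<open>r\<close> around \<open>f^n(z)\<close> leave \<open>U_n\<close> for infinitely many \<open>n\<close>, and let
  \<open>w_n\<close> be a boundary point of \<open>U_n\<close> nearest to \<open>f^n(z)\<close>.  A neighbourhood of the segment from
  \<open>f^n(z)\<close> to \<open>w_n\<close>, of width proportional to its length, misses \<open>P(f)\<close>.  It is a copy of one fixed
  domain; parametrise that domain by the unit disc and lift through \<open>f^n\<close>, starting at \<open>z\<close>.  The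
  lifts \<open>G_n\<close> omit \<open>P(f)\<close>, its preimage and the poles, at least two points in all, so a subsequence
  converges to some \<open>G\<close>, which sends the centre to \<open>z\<close> and a fixed point \<open>b\<close>, the parameter of
  \<open>w_n\<close>, into the Julia set.  Hence \<open>G\<close> is not constant, and by Hurwitz a fixed disc around \<open>G(b)\<close>
  lies in the image of \<open>G_n\<close> for all large \<open>n\<close> of the subsequence.  All iterates omit the exceptional
  points there, so \<open>G(b)\<close> lies in the Fatou set by Montel, a contradiction.
\<close>

section \<open>Montel's theorem in the chordal metric\<close>

lemma uniform_limit_cong_on:
  assumes "uniform_limit K f g F" "\<And>n x. x \<in> K \<Longrightarrow> f n x = f' n x" "\<And>x. x \<in> K \<Longrightarrow> g x = g' x"
  shows "uniform_limit K f' g' F"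
  using assms(1) by (subst uniform_limit_cong'[symmetric, of K f f' g g']) (auto simp: assms(2,3))

text \<open>\<open>K\<close> lies in a closed ball of radius \<open>\<rho>\<close> below
  \<open>R\<close>. Rescaling a slightly larger ball to the unit disc brings in Schottky's theorem,
  whose bound depends only on \<open>r\<close> and a ratio of radii, so one \<open>B\<close> serves
  all \<open>h\<close>.\<close>

lemma Schottky_bound_on_ball:
  assumes "0 < R" "compact K" "K \<subseteq> ball w R"
  obtains B where "\<And>h z. \<lbrakk>h holomorphic_on ball w R; \<And>x. x \<in> ball w R \<Longrightarrow> h x \<noteq> 0 \<and> h x \<noteq> 1;
                     norm (h w) \<le> r; z \<in> K\<rbrakk> \<Longrightarrow> norm (h z) \<le> B"
proof -
  obtain \<rho> where \<rho>: "0 < \<rho>" "\<rho> < R" "K \<subseteq> cball w \<rho>"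
  proof (cases "K = {}")
    case True then show ?thesis using that[of "R/2"] assms by auto
  next
    case False
    obtain x0 where x0: "x0 \<in> K" "\<And>x. x \<in> K \<Longrightarrow> dist w x \<le> dist w x0"
      using continuous_attains_sup[OF assms(2) False, of "dist w"] continuous_on_dist[OF continuous_on_const continuous_on_id]
      by blast
    have "dist w x0 < R" using x0 assms by auto
    then show ?thesis
    proof (intro that[of "(dist w x0 + R)/2"] subsetI)
      fix x assume "x \<in> K"
      then show "x \<in> cball w ((dist w x0 + R)/2)" using x0(2)[of x] \<open>dist w x0 < R\<close> by simp
    qed (use \<open>dist w x0 < R\<close> assms(1) in \<open>simp_all add: add_nonneg_pos\<close>)
  qed
  \<comment> \<open>Strictly between \<open>\<rho>\<close> and \<open>R\<close>: the rescaled
    function is then holomorphic on the closed unit disc, and \<open>K\<close> goes into the disc of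
    radius \<open>t\<close>, with \<open>t\<close> less than 1.\<close>
  define \<sigma> where "\<sigma> = (\<rho> + R) / 2"
  have \<sigma>: "\<rho> < \<sigma>" "\<sigma> < R" "0 < \<sigma>" using \<rho> by (auto simp: \<sigma>_def)
  define t where "t = \<rho> / \<sigma>"
  have t: "0 < t" "t < 1" using \<sigma> \<rho> by (auto simp: t_def)
  show ?thesis
  proof (rule that)
    fix h z
    assume h: "h holomorphic_on ball w R" "\<And>x. x \<in> ball w R \<Longrightarrow> h x \<noteq> 0 \<and> h x \<noteq> 1"
      "norm (h w) \<le> r" "z \<in> K"
    define k where "k = (\<lambda>x. h (w + of_real \<sigma> * x))"
    have in_b: "w + of_real \<sigma> * x \<in> ball w R" if "x \<in> cball 0 1" for x
    proof -
      have "norm (of_real \<sigma> * x) \<le> \<sigma> * 1"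
        unfolding norm_mult using that \<sigma> by (intro mult_mono) auto
      then show ?thesis using \<sigma> by (simp add: dist_norm)
    qed
    have hol: "k holomorphic_on cball 0 1"
      unfolding k_def
      by (rule holomorphic_on_compose_gen[OF _ h(1), unfolded o_def]) (use in_b in \<open>auto intro!: holomorphic_intros\<close>)
    define y where "y = (z - w) / of_real \<sigma>"
    have y: "norm y \<le> t"
      using h(4) \<rho>(3) \<sigma> by (auto simp: y_def t_def norm_divide dist_norm norm_minus_commute divide_simps)
    have "norm (k y) \<le> exp(pi * exp(pi * (2 + 2 * r + 12 * t / (1 - t))))"
      by (rule Schottky[OF hol _ _ t y]) (use h in_b in \<open>auto simp: k_def\<close>)
    moreover have "k y = h z" using \<sigma> by (simp add: k_def y_def)
    ultimately show "norm (h z) \<le> exp(pi * exp(pi * (2 + 2 * r + 12 * t / (1 - t))))" by simp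
  qed
qed

text \<open>The affine map taking \<open>a\<close> to 0 and \<open>b\<close> to 1 turns the omitted
  values into those of Schottky's theorem. The bound at the centre thus becomes a uniform bound on
  each compact subset, which is what Montel's theorem for locally bounded families requires.\<close>

lemma Montel_omitted_bounded_at_centre:
  fixes s :: "nat \<Rightarrow> complex \<Rightarrow> complex"
  assumes "0 < R" "a \<noteq> b"
    and hol: "\<And>n. s n holomorphic_on ball w R"
    and om: "\<And>n x. x \<in> ball w R \<Longrightarrow> s n x \<noteq> a \<and> s n x \<noteq> b"
    and bd: "\<And>n. norm (s n w) \<le> r"
  obtains g k where "g holomorphic_on ball w R" "strict_mono (k :: nat \<Rightarrow> nat)"
    "\<And>K. \<lbrakk>compact K; K \<subseteq> ball w R\<rbrakk> \<Longrightarrow> uniform_limit K (\<lambda>n. s (k n)) g sequentially"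
proof -
  have bound: "\<exists>B. \<forall>h \<in> range s. \<forall>z\<in>K. norm (h z) \<le> B" if K: "compact K" "K \<subseteq> ball w R" for K
  proof -
    obtain B where B: "\<And>h z. \<lbrakk>h holomorphic_on ball w R; \<And>x. x \<in> ball w R \<Longrightarrow> h x \<noteq> 0 \<and> h x \<noteq> 1;
                     norm (h w) \<le> (r + norm a) / norm (b - a); z \<in> K\<rbrakk> \<Longrightarrow> norm (h z) \<le> B"
      using Schottky_bound_on_ball[OF assms(1) K, of "(r + norm a) / norm (b - a)"] by metis
    have "norm (s n z) \<le> norm (b - a) * B + norm a" if z: "z \<in> K" for n z
    proof -
      have "norm ((s n z - a) / (b - a)) \<le> B"
      proof (rule B[of "\<lambda>z. (s n z - a) / (b - a)", OF _ _ _ z])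
        show "(\<lambda>z. (s n z - a) / (b - a)) holomorphic_on ball w R"
          using assms(2) by (intro holomorphic_intros hol) auto
        show "(s n x - a) / (b - a) \<noteq> 0 \<and> (s n x - a) / (b - a) \<noteq> 1" if "x \<in> ball w R" for x
          using om[OF that, of n] assms(2) by (auto simp: divide_simps)
        have "norm (s n w - a) \<le> r + norm a"
          using norm_triangle_ineq4[of "s n w" a] bd[of n] by linarith
        then show "norm ((s n w - a) / (b - a)) \<le> (r + norm a) / norm (b - a)"
          by (simp add: norm_divide divide_right_mono)
      qed
      then have "norm (s n z - a) \<le> norm (b - a) * B"
        using assms(2) by (simp add: norm_divide divide_simps mult.commute split: if_splits)
      then show ?thesis using norm_triangle_sub[of "s n z" a] by linarith
    qed
    then show ?thesis by blast
  qed
  obtain g k where gk: "g holomorphic_on ball w R" "strict_mono (k :: nat \<Rightarrow> nat)"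
    "\<And>K. \<lbrakk>compact K; K \<subseteq> ball w R\<rbrakk> \<Longrightarrow> uniform_limit K (s \<circ> k) g sequentially"
    by (rule Montel[of "ball w R" "range s" s, OF open_ball _ bound order.refl]) (use hol in auto)
  then show ?thesis using that[of g k] by (auto simp: o_def)
qed

text \<open>The inverse of the coordinate \<open>u = 1 / (z - a)\<close> of the sphere, in which
  infinity sits at \<open>u = 0\<close>. With \<open>a\<close> an omitted value of a family, the
  coordinate stays finite along it.\<close>

definition sphere_shifted_inverse :: "complex \<Rightarrow> complex \<Rightarrow> sphere" where
  "sphere_shifted_inverse a u = (if u = 0 then None else Some (a + inverse u))"

text \<open>Clearing the square of \<open>norm u\<close> from the denominators of the stereographic
  formula removes the singularity at \<open>u = 0\<close>, so continuity at infinity can be read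
  off. \<open>D\<close> is positive because \<open>u\<close> and \<open>1 + a * u\<close> have no
  common zero.\<close>

lemma stereo_sphere_shifted_inverse:
  fixes a u :: complex
  defines "D \<equiv> (norm u)\<^sup>2 + (norm (1 + a * u))\<^sup>2"
  shows "D > 0"
    and "stereo (sphere_shifted_inverse a u) =
      (2 * (1 + a * u) * cnj u / of_real D, ((norm (1 + a * u))\<^sup>2 - (norm u)\<^sup>2) / D)"
proof -
  show D: "D > 0"
  proof (cases "u = 0")
    case True then show ?thesis by (simp add: D_def)
  next
    case False then show ?thesis unfolding D_def by (simp add: add_pos_nonneg)
  qed
  show "stereo (sphere_shifted_inverse a u) =
      (2 * (1 + a * u) * cnj u / of_real D, ((norm (1 + a * u))\<^sup>2 - (norm u)\<^sup>2) / D)"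
  proof (cases "u = 0")
    case True then show ?thesis by (simp add: sphere_shifted_inverse_def stereo_def D_def)
  next
    case False
    define N where "N = norm (1 + a * u)"
    define q where "q = (norm u)\<^sup>2"
    have q: "q > 0" "of_real q = u * cnj u" using False by (simp_all add: q_def complex_norm_square flip: of_real_power)
    have z: "a + inverse u = (1 + a * u) / u" using False by (simp add: field_simps)
    have n: "(norm (a + inverse u))\<^sup>2 = N\<^sup>2 / q"
      unfolding z N_def q_def norm_divide power_divide ..
    have D': "D = q + N\<^sup>2" by (simp add: D_def N_def q_def)
    have c1: "1 + N\<^sup>2 / q = D / q" using q by (simp add: D' field_simps)
    have "2 * (a + inverse u) / of_real (1 + N\<^sup>2 / q) = 2 * (1 + a * u) * cnj u / of_real D"
    proof -
      have "2 * (a + inverse u) / of_real (D / q) = 2 * ((1 + a * u) / u) * of_real q / of_real D"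
        by (simp add: z)
      also have "\<dots> = 2 * (1 + a * u) * cnj u / of_real D"
        unfolding q(2) using False by simp
      finally show ?thesis unfolding c1 .
    qed
    moreover have "(N\<^sup>2 / q - 1) / (N\<^sup>2 / q + 1) = (N\<^sup>2 - q) / D"
    proof -
      have "N\<^sup>2 / q - 1 = (N\<^sup>2 - q) / q" using q by (simp add: field_simps)
      then show ?thesis using c1 q by (simp add: add.commute)
    qed
    ultimately show ?thesis
      using False by (simp add: sphere_shifted_inverse_def stereo_def n N_def[symmetric] q_def[symmetric])
  qed
qed

lemma continuous_stereo_sphere_shifted_inverse:
  "continuous_on UNIV (\<lambda>u. stereo (sphere_shifted_inverse a u))"
proof -
  have "(norm u)\<^sup>2 + (norm (1 + a * u))\<^sup>2 \<noteq> 0" for u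
    using stereo_sphere_shifted_inverse(1)[of u a] by linarith
  then show ?thesis
    unfolding stereo_sphere_shifted_inverse(2)
    by (intro continuous_intros) (auto simp flip: of_real_power of_real_add)
qed

lemma continuous_stereo_Some: "continuous_on UNIV (\<lambda>z. stereo (Some z))"
proof -
  have "1 + (norm z)\<^sup>2 \<noteq> 0" "(norm z)\<^sup>2 + 1 \<noteq> 0" for z :: complex
    by (smt (verit) zero_le_power2)+
  then show ?thesis
    unfolding stereo_def option.case
    by (intro continuous_intros) (simp_all del: of_real_add)
qed

text \<open>The image of \<open>K\<close> under \<open>g\<close> is bounded, so eventually all
  \<open>s n\<close> map \<open>K\<close> into one closed ball; on it \<open>\<Phi>\<close> is
  uniformly continuous by compactness.\<close>

lemma uniform_limit_continuous_compose:
  fixes s :: "nat \<Rightarrow> complex \<Rightarrow> complex" and \<Phi> :: "complex \<Rightarrow> 'b::metric_space"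
  assumes "continuous_on UNIV \<Phi>" "compact K" "continuous_on K g" "uniform_limit K s g sequentially"
  shows "uniform_limit K (\<lambda>n z. \<Phi> (s n z)) (\<lambda>z. \<Phi> (g z)) sequentially"
proof -
  have "bounded (g ` K)" using assms by (intro compact_imp_bounded compact_continuous_image)
  then obtain M where M: "\<And>z. z \<in> K \<Longrightarrow> norm (g z) \<le> M" by (auto simp: bounded_iff)
  show ?thesis
  proof (rule uniform_limit_compose_uniformly_continuous_on[OF assms(4), of "cball 0 (M + 1)"])
    show "uniformly_continuous_on (cball 0 (M + 1)) \<Phi>"
      using assms(1) by (intro compact_uniformly_continuous) (auto intro: continuous_on_subset)
    have "\<forall>\<^sub>F n in sequentially. \<forall>x\<in>K. dist (s n x) (g x) < 1"
      using assms(4) by (simp add: uniform_limit_iff)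
    then show "\<forall>\<^sub>F n in sequentially. \<forall>y\<in>K. s n y \<in> cball 0 (M + 1)"
    proof eventually_elim
      case (elim n)
      show ?case
      proof
        fix y assume y: "y \<in> K"
        have "norm (s n y) \<le> norm (g y) + norm (s n y - g y)" by (rule norm_triangle_sub)
        then show "s n y \<in> cball 0 (M + 1)" using elim[rule_format, OF y] M[OF y] by (auto simp: dist_norm)
      qed
    qed
  qed auto
qed

lemma normal_family_onI:
  assumes "\<And>s. range s \<subseteq> F \<Longrightarrow> \<exists>(k :: nat \<Rightarrow> nat) g. strict_mono k \<and>
           (\<forall>K. compact K \<and> K \<subseteq> V \<longrightarrow>
              uniform_limit K (\<lambda>j z. stereo (s (k j) z)) (\<lambda>z. stereo (g z)) sequentially)"
  shows "normal_family_on V F"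
  using assms unfolding normal_family_on_def by blast

text \<open>A bound at the centre comes from a choice of coordinate. Either infinitely many members
  have values within 1 of \<open>a\<close> there, or infinitely many of the functions
  \<open>1 / (h - a)\<close> are bounded by 1 there; the latter omit 0 and
  \<open>1 / (b - a)\<close>. A zero of the second kind of limit stands for the value
  infinity.\<close>

theorem Montel_omitting_two_values:
  assumes R: "0 < R" and ab: "a \<noteq> b"
    and F: "\<And>s. s \<in> F \<Longrightarrow> \<exists>h. h holomorphic_on ball w R \<and>
               (\<forall>x\<in>ball w R. h x \<noteq> a \<and> h x \<noteq> b \<and> s x = Some (h x))"
  shows "normal_family_on (ball w R) F"
proof (rule normal_family_onI)
  fix s :: "nat \<Rightarrow> complex \<Rightarrow> sphere"
  assume "range s \<subseteq> F"
  then have "\<exists>h. h holomorphic_on ball w R \<and> (\<forall>x\<in>ball w R. h x \<noteq> a \<and> h x \<noteq> b \<and> s n x = Some (h x))" for n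
    using F by auto
  then obtain h where h: "\<And>n. h n holomorphic_on ball w R"
      "\<And>n x. x \<in> ball w R \<Longrightarrow> h n x \<noteq> a \<and> h n x \<noteq> b"
      "\<And>n x. x \<in> ball w R \<Longrightarrow> s n x = Some (h n x)"
    by metis
  show "\<exists>(k :: nat \<Rightarrow> nat) g. strict_mono k \<and> (\<forall>K. compact K \<and> K \<subseteq> ball w R \<longrightarrow>
              uniform_limit K (\<lambda>j z. stereo (s (k j) z)) (\<lambda>z. stereo (g z)) sequentially)"
  proof (cases "infinite {n. norm (h n w - a) \<le> 1}")
    case True
    define e where "e = enumerate {n. norm (h n w - a) \<le> 1}"
    have e: "strict_mono e" "\<And>n. norm (h (e n) w - a) \<le> 1"
      using True strict_mono_enumerate enumerate_in_set[OF True] by (auto simp: e_def)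
    have "norm (h (e n) w) \<le> 1 + norm a" for n
      using e(2)[of n] norm_triangle_sub[of "h (e n) w" a] by linarith
    from this obtain g k where g: "g holomorphic_on ball w R" "strict_mono (k :: nat \<Rightarrow> nat)"
      "\<And>K. \<lbrakk>compact K; K \<subseteq> ball w R\<rbrakk> \<Longrightarrow> uniform_limit K (\<lambda>n. h (e (k n))) g sequentially"
      using Montel_omitted_bounded_at_centre[of R a b "\<lambda>n. h (e n)", OF R ab h(1) h(2)] by metis
    show ?thesis
    proof (intro exI[of _ "e \<circ> k"] exI[of _ "\<lambda>z. Some (g z)"] conjI allI impI)
      show "strict_mono (e \<circ> k)" using e(1) g(2) by (rule strict_mono_o)
      fix K assume K: "compact K \<and> K \<subseteq> ball w R"
      have "continuous_on K g" using g(1) K holomorphic_on_imp_continuous_on continuous_on_subset by blast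
      from uniform_limit_continuous_compose[OF continuous_stereo_Some _ this g(3)] K
      have lim: "uniform_limit K (\<lambda>n z. stereo (Some (h (e (k n)) z))) (\<lambda>z. stereo (Some (g z))) sequentially"
        by blast
      show "uniform_limit K (\<lambda>j z. stereo (s ((e \<circ> k) j) z)) (\<lambda>z. stereo (Some (g z))) sequentially"
        by (rule uniform_limit_cong_on[OF lim]) (use K h(3) in auto)
    qed
  next
    case False
    have inf: "infinite {n. \<not> norm (h n w - a) \<le> 1}"
    proof
      assume "finite {n. \<not> norm (h n w - a) \<le> 1}"
      with False have "finite ({n. norm (h n w - a) \<le> 1} \<union> {n. \<not> norm (h n w - a) \<le> 1})" by simp
      moreover have "{n. norm (h n w - a) \<le> 1} \<union> {n. \<not> norm (h n w - a) \<le> 1} = UNIV" by blast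
      ultimately show False by simp
    qed
    define e where "e = enumerate {n. \<not> norm (h n w - a) \<le> 1}"
    have e: "strict_mono e" "\<And>n. \<not> norm (h (e n) w - a) \<le> 1"
      using strict_mono_enumerate[OF inf] enumerate_in_set[OF inf] by (auto simp: e_def)
    define u where "u = (\<lambda>n z. inverse (h (e n) z - a))"
    have u1: "u n holomorphic_on ball w R" for n
      unfolding u_def using h by (intro holomorphic_intros) auto
    have u2: "u n x \<noteq> 0 \<and> u n x \<noteq> inverse (b - a)" if "x \<in> ball w R" for n x
      using h(2)[OF that, of "e n"] by (auto simp: u_def)
    have u3: "norm (u n w) \<le> 1" for n
      using e(2)[of n] by (simp add: u_def norm_inverse inverse_le_1_iff)
    have "0 \<noteq> inverse (b - a)" using ab by auto
    then obtain g k where g: "g holomorphic_on ball w R" "strict_mono (k :: nat \<Rightarrow> nat)"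
      "\<And>K. \<lbrakk>compact K; K \<subseteq> ball w R\<rbrakk> \<Longrightarrow> uniform_limit K (\<lambda>n. u (k n)) g sequentially"
      using Montel_omitted_bounded_at_centre[of R 0 "inverse (b - a)" u, OF R _ u1 u2 u3] by metis
    show ?thesis
    proof (intro exI[of _ "e \<circ> k"] exI[of _ "\<lambda>z. sphere_shifted_inverse a (g z)"] conjI allI impI)
      show "strict_mono (e \<circ> k)" using e(1) g(2) by (rule strict_mono_o)
      fix K assume K: "compact K \<and> K \<subseteq> ball w R"
      have "continuous_on K g" using g(1) K holomorphic_on_imp_continuous_on continuous_on_subset by blast
      from uniform_limit_continuous_compose[OF continuous_stereo_sphere_shifted_inverse[of a] _ this g(3)] K
      have lim: "uniform_limit K (\<lambda>n z. stereo (sphere_shifted_inverse a (u (k n) z)))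
              (\<lambda>z. stereo (sphere_shifted_inverse a (g z))) sequentially" by blast
      have eq: "sphere_shifted_inverse a (u (k n) z) = s (e (k n)) z" if "z \<in> K" for n z
      proof -
        have z: "z \<in> ball w R" using that K by auto
        show ?thesis using h(2)[OF z, of "e (k n)"] by (simp add: h(3)[OF z] sphere_shifted_inverse_def u_def)
      qed
      show "uniform_limit K (\<lambda>j z. stereo (s ((e \<circ> k) j) z)) (\<lambda>z. stereo (sphere_shifted_inverse a (g z))) sequentially"
        by (rule uniform_limit_cong_on[OF lim]) (simp_all add: eq)
    qed
  qed
qed

section \<open>Lifting through a meromorphic function\<close>

lemma glue_holomorphic:
  assumes "\<And>B h. (B, h) \<in> \<G> \<Longrightarrow> open B \<and> h holomorphic_on B"
    and compat: "\<And>B h B' h' x. \<lbrakk>(B, h) \<in> \<G>; (B', h') \<in> \<G>; x \<in> B; x \<in> B'\<rbrakk> \<Longrightarrow> h x = h' x"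
  obtains G where "G holomorphic_on (\<Union>(B, h)\<in>\<G>. B)" "\<And>B h x. \<lbrakk>(B, h) \<in> \<G>; x \<in> B\<rbrakk> \<Longrightarrow> G x = h x"
proof -
  define G where "G = (\<lambda>x. THE y. \<exists>B h. (B, h) \<in> \<G> \<and> x \<in> B \<and> y = h x)"
  have G: "G x = h x" if "(B, h) \<in> \<G>" "x \<in> B" for B h x
    unfolding G_def by (rule the_equality) (use that compat in blast)+
  have hol: "G holomorphic_on B" if "(B, h) \<in> \<G>" for B h
    using assms(1)[OF that] G[OF that] by (simp cong: holomorphic_cong)
  have "G holomorphic_on (\<Union>(B, h)\<in>\<G>. B)"
    unfolding holomorphic_on_def
  proof
    fix x assume "x \<in> (\<Union>(B, h)\<in>\<G>. B)"
    then obtain B h where "(B, h) \<in> \<G>" "x \<in> B" by auto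
    then have "G field_differentiable at x"
      using hol assms(1) holomorphic_on_imp_differentiable_at by blast
    then show "G field_differentiable at x within (\<Union>(B, h)\<in>\<G>. B)"
      by (rule field_differentiable_at_within)
  qed
  then show ?thesis using that G by metis
qed

text \<open>At a pole the value of \<open>f\<close> is the dummy 0, so the equation alone would
  accept a pole as a preimage of 0; hence the condition on poles.\<close>

definition lifts :: "(complex \<Rightarrow> complex) \<Rightarrow> (complex \<Rightarrow> complex) \<Rightarrow> complex set \<Rightarrow> (complex \<Rightarrow> complex) \<Rightarrow> bool" where
  "lifts f \<phi> D g \<longleftrightarrow> g holomorphic_on D \<and> (\<forall>z\<in>D. \<not> is_pole f (g z) \<and> f (g z) = \<phi> z)"

lemma lifts_subset: "lifts f \<phi> D g \<Longrightarrow> D' \<subseteq> D \<Longrightarrow> lifts f \<phi> D' g"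
  by (auto simp: lifts_def intro: holomorphic_on_subset)

lemma glue_lifts:
  assumes "\<And>B h. (B, h) \<in> \<G> \<Longrightarrow> open B \<and> lifts f \<phi> B h"
    and compat: "\<And>B h B' h' x. \<lbrakk>(B, h) \<in> \<G>; (B', h') \<in> \<G>; x \<in> B; x \<in> B'\<rbrakk> \<Longrightarrow> h x = h' x"
  obtains G where "lifts f \<phi> (\<Union>(B, h)\<in>\<G>. B) G" "\<And>B h x. \<lbrakk>(B, h) \<in> \<G>; x \<in> B\<rbrakk> \<Longrightarrow> G x = h x"
proof -
  obtain G where G: "G holomorphic_on (\<Union>(B, h)\<in>\<G>. B)" "\<And>B h x. \<lbrakk>(B, h) \<in> \<G>; x \<in> B\<rbrakk> \<Longrightarrow> G x = h x"
  proof (rule glue_holomorphic[of \<G>])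
    show "open B \<and> h holomorphic_on B" if "(B, h) \<in> \<G>" for B h
      using assms(1)[OF that] by (auto simp: lifts_def)
    show "h x = h' x" if "(B, h) \<in> \<G>" "(B', h') \<in> \<G>" "x \<in> B" "x \<in> B'" for B h B' h' x
      using compat[OF that] .
  qed blast
  have "lifts f \<phi> (\<Union>(B, h)\<in>\<G>. B) G"
    unfolding lifts_def
  proof (intro conjI G(1) ballI)
    fix z assume "z \<in> (\<Union>(B, h)\<in>\<G>. B)"
    then obtain B h where "(B, h) \<in> \<G>" "z \<in> B" by auto
    then show "\<not> is_pole f (G z)" "f (G z) = \<phi> z" using assms(1)[of B h] G(2)[of B h z] by (auto simp: lifts_def)
  qed
  then show ?thesis using that G(2) by blast
qed

section \<open>Local inverses and analytic continuation of lifts\<close>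

locale nicely_meromorphic =
  fixes f :: "complex \<Rightarrow> complex"
  assumes nicely_meromorphic: "f nicely_meromorphic_on UNIV"
begin

lemma holomorphic_near_nonpole:
  assumes "\<not> is_pole f a"
  obtains r where "0 < r" "f holomorphic_on ball a r" "\<And>z. z \<in> ball a r \<Longrightarrow> \<not> is_pole f z"
proof -
  have "f analytic_on {a}"
    using nicely_meromorphic_on_imp_analytic_at[OF nicely_meromorphic] assms by simp
  then obtain r where r: "0 < r" "f holomorphic_on ball a r" by (auto simp: analytic_on_def)
  then show ?thesis using that not_is_pole_holomorphic[OF open_ball] by blast
qed

lemma holomorphic_on_nonpoles: "f holomorphic_on {z. \<not> is_pole f z}"
proof -
  have "f analytic_on {z. \<not> is_pole f z}"
    using nicely_meromorphic_on_imp_analytic_at[OF nicely_meromorphic] by (subst analytic_on_analytic_at) auto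
  then show ?thesis by (rule analytic_imp_holomorphic)
qed

lemma isCont_nonpole: "\<not> is_pole f a \<Longrightarrow> isCont f a"
  using nicely_meromorphic_on_imp_analytic_at[OF nicely_meromorphic] analytic_at_imp_isCont by blast

lemma open_nonpoles: "open {z. \<not> is_pole f z}"
  unfolding open_contains_ball using holomorphic_near_nonpole
  by (metis mem_Collect_eq subsetI)

lemma deriv_nonzero: "\<not> is_pole f a \<Longrightarrow> f a \<notin> singular_values f \<Longrightarrow> deriv f a \<noteq> 0"
  by (auto simp: singular_values_def critical_values_def)

lemma local_inverse:
  assumes "\<not> is_pole f a" "deriv f a \<noteq> 0"
  obtains r h where "0 < r" "\<And>z. z \<in> ball a r \<Longrightarrow> \<not> is_pole f z" "f holomorphic_on ball a r"
    "inj_on f (ball a r)" "open (f ` ball a r)" "h holomorphic_on f ` ball a r" "\<And>z. z \<in> ball a r \<Longrightarrow> h (f z) = z"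
proof -
  obtain r where r: "r > 0" "ball a r \<subseteq> {z. \<not> is_pole f z}" "inj_on f (ball a r)"
    using has_complex_derivative_locally_injective[OF holomorphic_on_nonpoles _ open_nonpoles assms(2)] assms(1)
    by blast
  have hol: "f holomorphic_on ball a r"
    using r holomorphic_on_nonpoles holomorphic_on_subset by blast
  obtain h where "h holomorphic_on f ` ball a r" "\<And>z. z \<in> ball a r \<Longrightarrow> h (f z) = z"
    using holomorphic_has_inverse[OF hol open_ball r(3)] by metis
  then show ?thesis using that r hol open_mapping_thm3[OF hol open_ball r(3)] by blast
qed

text \<open>Near \<open>x\<close> both lifts take values in a ball on which \<open>f\<close> is
  injective, because \<open>\<phi> x\<close> is not a critical value. So they agree near
  \<open>x\<close>, and the identity theorem spreads this over \<open>D\<close>.\<close>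

lemma lifts_unique:
  assumes D: "open D" "connected D" and g: "lifts f \<phi> D g1" "lifts f \<phi> D g2"
    and sing: "\<And>z. z \<in> D \<Longrightarrow> \<phi> z \<notin> singular_values f"
    and x: "x \<in> D" "g1 x = g2 x" and z: "z \<in> D"
  shows "g1 z = g2 z"
proof -
  have "\<not> is_pole f (g1 x)" "deriv f (g1 x) \<noteq> 0"
    using g(1) x(1) sing[OF x(1)] deriv_nonzero[of "g1 x"] by (auto simp: lifts_def)
  then obtain r h where r: "0 < r" "inj_on f (ball (g1 x) r)"
    using local_inverse by metis
  have cont: "continuous_on D g1" "continuous_on D g2"
    using g by (auto simp: lifts_def intro: holomorphic_on_imp_continuous_on)
  define N where "N = (g1 -` ball (g1 x) r \<inter> D) \<inter> (g2 -` ball (g1 x) r \<inter> D)"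
  have vim: "open (g -` ball (g1 x) r \<inter> D)" if "continuous_on D g" for g
    using continuous_on_open_vimage[OF D(1), of g] that open_ball by blast
  have N: "open N" unfolding N_def by (intro open_Int vim cont)
  show ?thesis
  proof (rule analytic_continuation_open[where f = g1 and g = g2, OF N D(1) _ D(2)])
    have "x \<in> N" using x r(1) by (simp add: N_def)
    then show "N \<noteq> {}" by blast
    show "g1 y = g2 y" if "y \<in> N" for y
    proof (rule inj_onD[OF r(2)])
      show "f (g1 y) = f (g2 y)" using that g by (auto simp: N_def lifts_def)
    qed (use that in \<open>auto simp: N_def\<close>)
  qed (use g z in \<open>auto simp: N_def lifts_def\<close>)
qed

text \<open>Follow the lift along the radius towards \<open>\<zeta>\<close>. It cannot tend to
  infinity, since \<open>\<phi> \<zeta>\<close> is not an asymptotic value, so it has a finite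
  accumulation point \<open>a\<close>. This is not a pole, lies over \<open>\<phi> \<zeta>\<close>
  and is not critical; the local inverse of \<open>f\<close> at \<open>a\<close> continues the
  lift.\<close>

lemma extend_lift_at_boundary_point:
  assumes R: "0 < R" "R < T" and phi: "\<phi> holomorphic_on ball c T"
    and sing: "\<And>z. z \<in> ball c T \<Longrightarrow> \<phi> z \<notin> singular_values f"
    and g: "lifts f \<phi> (ball c R) g" and \<zeta>: "dist c \<zeta> = R"
  obtains \<eta> h where "0 < \<eta>" "ball \<zeta> \<eta> \<subseteq> ball c T" "lifts f \<phi> (ball \<zeta> \<eta>) h"
    "\<And>z. z \<in> ball \<zeta> \<eta> \<inter> ball c R \<Longrightarrow> h z = g z"
proof -
  \<comment> \<open>The radius is parametrised by a half-line because
    \<open>asymptotic_values\<close> uses paths on \<open>{0..}\<close>; \<open>y\<close> starts at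
    \<open>c\<close> and tends to \<open>\<zeta>\<close>.\<close>
  define y :: "real \<Rightarrow> complex" where "y = (\<lambda>t. c + of_real (t / (t + 1)) * (\<zeta> - c))"
  have \<zeta>T: "\<zeta> \<in> ball c T" using R \<zeta> by simp
  have contphi: "continuous_on (ball c T) \<phi>" by (rule holomorphic_on_imp_continuous_on[OF phi])
  have y_in: "y t \<in> ball c R" if "t \<ge> 0" for t
  proof -
    have "dist c (y t) = t / (t + 1) * R"
      using that \<zeta> by (simp add: y_def dist_norm norm_mult norm_minus_commute flip: of_real_add of_real_divide)
    also have "\<dots> < 1 * R" using that R by (intro mult_strict_right_mono) auto
    finally show ?thesis by simp
  qed
  have "((\<lambda>t::real. t / (t + 1)) \<longlongrightarrow> 1) at_top" by real_asymp
  then have "(y \<longlongrightarrow> c + of_real 1 * (\<zeta> - c)) at_top"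
    unfolding y_def by (intro tendsto_intros)
  then have y_lim: "(y \<longlongrightarrow> \<zeta>) at_top" by simp
  have conty: "continuous_on {0..} y"
    unfolding y_def by (intro continuous_intros) auto
  have phi_lim: "((\<lambda>t. \<phi> (y t)) \<longlongrightarrow> \<phi> \<zeta>) at_top"
    by (rule isCont_tendsto_compose[OF _ y_lim])
       (use contphi \<zeta>T continuous_on_eq_continuous_at open_ball in blast)
  have g_cont: "continuous_on (ball c R) g" using g by (auto simp: lifts_def intro: holomorphic_on_imp_continuous_on)
  have "\<not> filterlim (\<lambda>t. g (y t)) at_infinity at_top"
  proof
    assume inf: "filterlim (\<lambda>t. g (y t)) at_infinity at_top"
    have ev: "\<forall>\<^sub>F t in at_top. \<not> is_pole f (g (y t)) \<and> f (g (y t)) = \<phi> (y t)"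
      using eventually_ge_at_top[of 0] by eventually_elim (use g y_in in \<open>auto simp: lifts_def\<close>)
    have "((\<lambda>t. f (g (y t))) \<longlongrightarrow> \<phi> \<zeta>) at_top"
      by (rule Lim_transform_eventually[OF phi_lim]) (use ev in \<open>auto elim: eventually_mono\<close>)
    moreover have "continuous_on {0..} (\<lambda>t. g (y t))"
      by (rule continuous_on_compose2[OF g_cont conty]) (use y_in in auto)
    ultimately have "\<phi> \<zeta> \<in> asymptotic_values f"
      unfolding asymptotic_values_def using inf ev
      by (intro CollectI exI[of _ "\<lambda>t. g (y t)"]) (auto elim: eventually_mono)
    then show False using sing[OF \<zeta>T] by (simp add: singular_values_def)
  qed
  \<comment> \<open>Failing to tend to infinity means only that the values are frequently bounded,
    so times \<open>t n\<close> going to infinity are selected before compactness supplies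
    \<open>a\<close>.\<close>
  then obtain M where "\<not> (\<forall>\<^sub>F t in at_top. M \<le> norm (g (y t)))"
    unfolding filterlim_at_infinity[OF order.refl] by blast
  then have M: "\<exists>\<^sub>F t in at_top. norm (g (y t)) < M"
    by (simp add: not_eventually not_le)
  have "\<exists>t\<ge>real n. norm (g (y t)) < M" for n
    using frequently_eventually_conj[OF M eventually_ge_at_top[of "real n"]] frequently_ex by blast
  then obtain t where t: "\<And>n. t n \<ge> real n" "\<And>n. norm (g (y (t n))) < M" by metis
  have "\<exists>a\<in>cball 0 M. \<exists>k. strict_mono k \<and> ((\<lambda>n. g (y (t n))) \<circ> k) \<longlonglongrightarrow> a"
    using compact_imp_seq_compact[OF compact_cball[of 0 M]] t(2) less_imp_le
    unfolding seq_compact_def by (metis mem_cball_0)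
  then obtain a k where k: "strict_mono (k :: nat \<Rightarrow> nat)" and a: "(\<lambda>n. g (y (t (k n)))) \<longlonglongrightarrow> a"
    by (auto simp: o_def)
  have t_lim: "filterlim (\<lambda>n. t (k n)) at_top sequentially"
  proof (rule filterlim_at_top_mono[OF filterlim_real_sequentially], intro always_eventually allI)
    show "real n \<le> t (k n)" for n
      using t(1)[of "k n"] seq_suble[OF k, of n] by linarith
  qed
  have t0: "t n \<ge> 0" for n using t(1)[of n] by (meson of_nat_0_le_iff order_trans)
  define x where "x = (\<lambda>n. y (t (k n)))"
  have x: "x n \<in> ball c R" for n using y_in t0 by (simp add: x_def)
  have x_lim: "x \<longlonglongrightarrow> \<zeta>" unfolding x_def by (rule filterlim_compose[OF y_lim t_lim])
  have phix_lim: "(\<lambda>n. \<phi> (x n)) \<longlonglongrightarrow> \<phi> \<zeta>" unfolding x_def by (rule filterlim_compose[OF phi_lim t_lim])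
  have gx: "\<not> is_pole f (g (x n))" "f (g (x n)) = \<phi> (x n)" for n using g x by (auto simp: lifts_def)
  have ax: "(\<lambda>n. g (x n)) \<longlonglongrightarrow> a" using a by (simp add: x_def)
  \<comment> \<open>A pole at \<open>a\<close> would send \<open>f (g (x n))\<close>, that is
    \<open>\<phi> (x n)\<close>, to infinity, whereas it converges to
    \<open>\<phi> \<zeta>\<close>.\<close>
  have np: "\<not> is_pole f a"
  proof
    assume p: "is_pole f a"
    have "filterlim (\<lambda>n. g (x n)) (at a) sequentially"
      unfolding filterlim_at using ax gx(1) p by (auto intro!: always_eventually)
    from filterlim_compose[OF p[unfolded is_pole_def] this]
    have "filterlim (\<lambda>n. \<phi> (x n)) at_infinity sequentially" by (simp add: gx)
    then show False using not_tendsto_and_filterlim_at_infinity[OF _ phix_lim] by simp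
  qed
  have "(\<lambda>n. f (g (x n))) \<longlonglongrightarrow> f a" by (rule isCont_tendsto_compose[OF isCont_nonpole[OF np] ax])
  then have fa: "f a = \<phi> \<zeta>" using phix_lim LIMSEQ_unique by (simp add: gx)
  have "deriv f a \<noteq> 0" using deriv_nonzero np fa sing[OF \<zeta>T] by simp
  then obtain r h where r: "0 < r" "\<And>z. z \<in> ball a r \<Longrightarrow> \<not> is_pole f z"
    "open (f ` ball a r)" "h holomorphic_on f ` ball a r" "\<And>z. z \<in> ball a r \<Longrightarrow> h (f z) = z"
    using local_inverse[OF np] by metis
  have "open (\<phi> -` (f ` ball a r) \<inter> ball c T)"
    using continuous_on_open_vimage[OF open_ball] contphi r(3) by blast
  moreover have "\<zeta> \<in> \<phi> -` (f ` ball a r) \<inter> ball c T" using \<zeta>T fa r(1) by (auto intro!: image_eqI[of _ _ a])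
  ultimately obtain \<eta> where \<eta>: "0 < \<eta>" "ball \<zeta> \<eta> \<subseteq> \<phi> -` (f ` ball a r) \<inter> ball c T"
    by (meson open_contains_ball)
  have lift: "lifts f \<phi> (ball \<zeta> \<eta>) (h \<circ> \<phi>)"
    unfolding lifts_def
  proof (intro conjI ballI)
    show "h \<circ> \<phi> holomorphic_on ball \<zeta> \<eta>"
      by (rule holomorphic_on_compose_gen[OF _ r(4)]) (use \<eta> phi in \<open>auto intro: holomorphic_on_subset\<close>)
    fix z assume "z \<in> ball \<zeta> \<eta>"
    then obtain v where "v \<in> ball a r" "\<phi> z = f v" using \<eta> by blast
    then show "\<not> is_pole f ((h \<circ> \<phi>) z)" "f ((h \<circ> \<phi>) z) = \<phi> z" using r(2,5) by auto
  qed
  \<comment> \<open>One index \<open>n\<close> with \<open>x n\<close> near \<open>\<zeta>\<close>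
    and \<open>g (x n)\<close> near \<open>a\<close> suffices: there \<open>h\<close> inverts
    \<open>f\<close>, so \<open>h \<circ> \<phi>\<close> and \<open>g\<close> agree at
    \<open>x n\<close>, and uniqueness spreads this over the convex intersection.\<close>
  have "\<forall>\<^sub>F n in sequentially. x n \<in> ball \<zeta> \<eta>" "\<forall>\<^sub>F n in sequentially. g (x n) \<in> ball a r"
    using x_lim ax \<eta>(1) r(1) by (auto simp: tendsto_iff dist_commute)
  then have "\<forall>\<^sub>F n in sequentially. x n \<in> ball \<zeta> \<eta> \<and> g (x n) \<in> ball a r" by eventually_elim auto
  then obtain n where n: "x n \<in> ball \<zeta> \<eta>" "g (x n) \<in> ball a r"
    using eventually_happens by force
  show ?thesis
  proof (rule that[OF \<eta>(1) _ lift])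
    show "ball \<zeta> \<eta> \<subseteq> ball c T" using \<eta> by auto
    fix z assume z: "z \<in> ball \<zeta> \<eta> \<inter> ball c R"
    show "(h \<circ> \<phi>) z = g z"
    proof (rule lifts_unique[OF _ _ _ _ _ _ _ z])
      show "open (ball \<zeta> \<eta> \<inter> ball c R)" "connected (ball \<zeta> \<eta> \<inter> ball c R)"
        by (auto intro: convex_connected convex_Int)
      show "lifts f \<phi> (ball \<zeta> \<eta> \<inter> ball c R) (h \<circ> \<phi>)" "lifts f \<phi> (ball \<zeta> \<eta> \<inter> ball c R) g"
        using lift g by (auto intro: lifts_subset)
      show "x n \<in> ball \<zeta> \<eta> \<inter> ball c R" using n x by auto
      show "(h \<circ> \<phi>) (x n) = g (x n)" using r(5)[OF n(2)] gx by simp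
      show "\<phi> z \<notin> singular_values f" if "z \<in> ball \<zeta> \<eta> \<inter> ball c R" for z
        using that sing[of z] R by auto
    qed
  qed
qed

text \<open>The continuations at the points of the circle agree with \<open>g\<close> and with each
  other. Glued together with \<open>g\<close> they live on an open set containing the closed disc,
  which by compactness contains a larger disc.\<close>

lemma extend_lift:
  assumes R: "0 < R" "R < T" and phi: "\<phi> holomorphic_on ball c T"
    and sing: "\<And>z. z \<in> ball c T \<Longrightarrow> \<phi> z \<notin> singular_values f"
    and g: "lifts f \<phi> (ball c R) g"
  obtains R' h where "R < R'" "R' \<le> T" "lifts f \<phi> (ball c R') h" "h c = g c"
proof -
  have "\<forall>\<zeta>\<in>sphere c R. \<exists>\<eta> h. 0 < \<eta> \<and> ball \<zeta> \<eta> \<subseteq> ball c T \<and> lifts f \<phi> (ball \<zeta> \<eta>) h \<and>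
    (\<forall>z\<in>ball \<zeta> \<eta> \<inter> ball c R. h z = g z)"
    using extend_lift_at_boundary_point[OF R phi sing g] by (metis mem_sphere)
  then obtain \<eta> H where H: "\<And>\<zeta>. \<zeta> \<in> sphere c R \<Longrightarrow> 0 < \<eta> \<zeta> \<and> ball \<zeta> (\<eta> \<zeta>) \<subseteq> ball c T \<and>
      lifts f \<phi> (ball \<zeta> (\<eta> \<zeta>)) (H \<zeta>) \<and> (\<forall>z\<in>ball \<zeta> (\<eta> \<zeta>) \<inter> ball c R. H \<zeta> z = g z)"
    by metis
  define \<G> where "\<G> = insert (ball c R, g) ((\<lambda>\<zeta>. (ball \<zeta> (\<eta> \<zeta>), H \<zeta>)) ` sphere c R)"
  have compat: "H \<zeta> z = H \<zeta>' z"
    if \<zeta>: "\<zeta> \<in> sphere c R" "\<zeta>' \<in> sphere c R" and z: "z \<in> ball \<zeta> (\<eta> \<zeta>) \<inter> ball \<zeta>' (\<eta> \<zeta>')" for \<zeta> \<zeta>' z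
  proof -
    let ?D = "ball \<zeta> (\<eta> \<zeta>) \<inter> ball \<zeta>' (\<eta> \<zeta>')"
    \<comment> \<open>Overlapping discs centred on the circle also overlap inside
      \<open>ball c R\<close>: the point \<open>p\<close> dividing the segment from
      \<open>\<zeta>\<close> to \<open>\<zeta>'\<close> in the ratio of the two radii lies in both
      discs and, by convexity, in \<open>cball c R\<close>.\<close>
    have "?D \<inter> ball c R \<noteq> {}"
    proof -
      have "dist \<zeta> \<zeta>' < \<eta> \<zeta> + \<eta> \<zeta>'" using z dist_triangle_less_add[of \<zeta> z "\<eta> \<zeta>" \<zeta>' "\<eta> \<zeta>'"]
        by (simp add: dist_commute)
      moreover have pos: "0 < \<eta> \<zeta>" "0 < \<eta> \<zeta>'" using H \<zeta> by auto
      define u where "u = \<eta> \<zeta> / (\<eta> \<zeta> + \<eta> \<zeta>')"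
      define p where "p = \<zeta> + of_real u * (\<zeta>' - \<zeta>)"
      have u: "0 \<le> u" "u \<le> 1" "1 - u = \<eta> \<zeta>' / (\<eta> \<zeta> + \<eta> \<zeta>')" using pos by (auto simp: u_def divide_simps)
      have "dist \<zeta> p = u * dist \<zeta> \<zeta>'" using u by (simp add: p_def dist_norm norm_mult norm_minus_commute)
      moreover have "\<zeta>' - p = of_real (1 - u) * (\<zeta>' - \<zeta>)" by (simp add: p_def algebra_simps)
      then have "dist \<zeta>' p = \<bar>1 - u\<bar> * dist \<zeta> \<zeta>'"
        by (simp only: dist_norm norm_mult norm_of_real norm_minus_commute[of \<zeta>' \<zeta>])
      then have "dist \<zeta>' p = (1 - u) * dist \<zeta> \<zeta>'" using u(2) by simp
      moreover have "u * dist \<zeta> \<zeta>' < \<eta> \<zeta>" "(1 - u) * dist \<zeta> \<zeta>' < \<eta> \<zeta>'"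
        unfolding u(3) unfolding u_def using \<open>dist \<zeta> \<zeta>' < \<eta> \<zeta> + \<eta> \<zeta>'\<close> pos
        by (simp_all add: pos_divide_less_eq)
      ultimately have "p \<in> ?D" by simp
      moreover have "p \<in> closure (ball c R)"
      proof -
        have "p = (1 - u) *\<^sub>R \<zeta> + u *\<^sub>R \<zeta>'" by (simp add: p_def scaleR_conv_of_real algebra_simps)
        then have "p \<in> cball c R"
          using convexD[OF convex_cball[of c R], of \<zeta> \<zeta>' "1 - u" u] \<zeta> u by auto
        then show ?thesis using R by simp
      qed
      moreover have "open ?D" by auto
      ultimately show ?thesis using open_Int_closure_eq_empty by blast
    qed
    then obtain x where x: "x \<in> ?D" "x \<in> ball c R" by blast
    show ?thesis
    proof (rule lifts_unique[OF _ _ _ _ _ x(1) _ z])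
      show "open ?D" "connected ?D" by (auto intro: convex_connected convex_Int)
      show "lifts f \<phi> ?D (H \<zeta>)" "lifts f \<phi> ?D (H \<zeta>')" using H \<zeta> by (auto intro: lifts_subset)
      show "H \<zeta> x = H \<zeta>' x" using H \<zeta> x by auto
      show "\<phi> z \<notin> singular_values f" if "z \<in> ?D" for z using that sing[of z] H \<zeta> by blast
    qed
  qed
  obtain G where G: "lifts f \<phi> (\<Union>(B, h)\<in>\<G>. B) G" "\<And>B h x. \<lbrakk>(B, h) \<in> \<G>; x \<in> B\<rbrakk> \<Longrightarrow> G x = h x"
  proof (rule glue_lifts[of \<G>])
    show "open B \<and> lifts f \<phi> B h" if "(B, h) \<in> \<G>" for B h using that g H by (auto simp: \<G>_def)
    have cases: "B = ball c R \<and> h = g \<or> (\<exists>\<zeta>\<in>sphere c R. B = ball \<zeta> (\<eta> \<zeta>) \<and> h = H \<zeta>)"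
      if "(B, h) \<in> \<G>" for B h using that by (auto simp: \<G>_def)
    have agree: "H \<zeta> x = g x" if "\<zeta> \<in> sphere c R" "x \<in> ball \<zeta> (\<eta> \<zeta>)" "x \<in> ball c R" for \<zeta> x
      using H[OF that(1)] that by blast
    fix B h B' h' x
    assume "(B, h) \<in> \<G>" "(B', h') \<in> \<G>" "x \<in> B" "x \<in> B'"
    then show "h x = h' x"
      using cases[of B h] cases[of B' h'] compat[of _ _ x] agree[of _ x] by (metis IntI)
  qed blast
  have "cball c R \<subseteq> (\<Union>(B, h)\<in>\<G>. B)"
  proof
    fix z assume "z \<in> cball c R"
    then consider "z \<in> ball c R" | "z \<in> sphere c R" by fastforce
    then show "z \<in> (\<Union>(B, h)\<in>\<G>. B)"
    proof cases
      case 2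
      then have "(ball z (\<eta> z), H z) \<in> \<G>" by (simp add: \<G>_def)
      then show ?thesis using H[OF 2] by (intro UN_I[of "(ball z (\<eta> z), H z)"]) auto
    qed (auto simp: \<G>_def)
  qed
  moreover have "open (\<Union>(B, h)\<in>\<G>. B)" by (auto simp: \<G>_def)
  ultimately obtain e where e: "e > 0" "(\<Union>x\<in>cball c R. ball x e) \<subseteq> (\<Union>(B, h)\<in>\<G>. B)"
    using compact_subset_open_imp_ball_epsilon_subset[OF compact_cball] by metis
  define R' where "R' = min T (R + e)"
  have sub: "ball c R' \<subseteq> (\<Union>x\<in>cball c R. ball x e)"
  proof
    fix z assume z: "z \<in> ball c R'"
    show "z \<in> (\<Union>x\<in>cball c R. ball x e)"
    proof (cases "z \<in> cball c R")
      case True then show ?thesis using e by (intro UN_I[of z]) auto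
    next
      case False
      define d where "d = dist c z"
      have d: "R < d" "d < R + e" using False z by (auto simp: d_def R'_def)
      \<comment> \<open>The radial projection of \<open>z\<close> to the circle of radius
        \<open>R\<close>; its distance to \<open>z\<close> is \<open>d - R\<close>, less than
        \<open>e\<close>.\<close>
      define x where "x = c + of_real (R / d) * (z - c)"
      have "c \<noteq> z" using False R by auto
      then have "dist c x = R" using d R by (simp add: x_def dist_norm norm_mult norm_divide d_def norm_minus_commute)
      moreover have "z - x = of_real (1 - R / d) * (z - c)" by (simp add: x_def algebra_simps)
      then have "dist x z = \<bar>1 - R / d\<bar> * d"
        by (simp only: dist_norm norm_minus_commute[of x] norm_mult norm_of_real d_def norm_minus_commute[of c])
      then have "dist x z = (1 - R / d) * d" using d R by simp
      then have "dist x z < e" using d R by (simp add: left_diff_distrib)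
      ultimately show ?thesis by (intro UN_I[of x]) auto
    qed
  qed
  show ?thesis
  proof (rule that)
    show "R < R'" "R' \<le> T" using e R by (auto simp: R'_def)
    show "lifts f \<phi> (ball c R') G" by (rule lifts_subset[OF G(1)]) (use sub e in blast)
    show "G c = g c" by (rule G(2)) (use R in \<open>auto simp: \<G>_def\<close>)
  qed
qed

text \<open>Continuation in the radius: the lifts through \<open>x0\<close> on concentric discs
  agree by uniqueness and glue to a lift on the disc of supremal radius \<open>R\<close>. If
  \<open>R\<close> were below \<open>T\<close>, \<open>extend_lift\<close> would go beyond the
  supremum.\<close>

proposition lift_on_ball:
  assumes T: "0 < T" and phi: "\<phi> holomorphic_on ball c T"
    and sing: "\<And>z. z \<in> ball c T \<Longrightarrow> \<phi> z \<notin> singular_values f"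
    and x0: "\<not> is_pole f x0" "f x0 = \<phi> c"
  obtains g where "lifts f \<phi> (ball c T) g" "g c = x0"
proof -
  define S where "S = {\<rho>. 0 < \<rho> \<and> \<rho> \<le> T \<and> (\<exists>g. lifts f \<phi> (ball c \<rho>) g \<and> g c = x0)}"
  have cT: "c \<in> ball c T" using T by simp
  obtain r h where r: "0 < r" "\<And>z. z \<in> ball x0 r \<Longrightarrow> \<not> is_pole f z"
    "open (f ` ball x0 r)" "h holomorphic_on f ` ball x0 r" "\<And>z. z \<in> ball x0 r \<Longrightarrow> h (f z) = z"
    using local_inverse[OF x0(1)] deriv_nonzero[OF x0(1)] sing[OF cT] x0(2) by metis
  have "open (\<phi> -` (f ` ball x0 r) \<inter> ball c T)"
    using continuous_on_open_vimage[OF open_ball] holomorphic_on_imp_continuous_on[OF phi] r(3) by blast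
  moreover have "c \<in> \<phi> -` (f ` ball x0 r) \<inter> ball c T" using cT x0(2) r(1) by (auto intro!: image_eqI[of _ _ x0])
  ultimately obtain \<eta> where \<eta>: "0 < \<eta>" "ball c \<eta> \<subseteq> \<phi> -` (f ` ball x0 r) \<inter> ball c T"
    by (meson open_contains_ball)
  have lift: "lifts f \<phi> (ball c \<eta>) (h \<circ> \<phi>)"
    unfolding lifts_def
  proof (intro conjI ballI)
    show "h \<circ> \<phi> holomorphic_on ball c \<eta>"
      by (rule holomorphic_on_compose_gen[OF _ r(4)]) (use \<eta> phi in \<open>auto intro: holomorphic_on_subset\<close>)
    fix z assume "z \<in> ball c \<eta>"
    then obtain v where "v \<in> ball x0 r" "\<phi> z = f v" using \<eta> by blast
    then show "\<not> is_pole f ((h \<circ> \<phi>) z)" "f ((h \<circ> \<phi>) z) = \<phi> z" using r(2,5) by auto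
  qed
  have "min \<eta> T \<in> S"
    unfolding S_def using \<eta>(1) T r(1) r(5)[of x0] x0(2)
    by (auto intro!: exI[of _ "h \<circ> \<phi>"] lifts_subset[OF lift])
  then have ne: "S \<noteq> {}" by blast
  have bdd: "bdd_above S" by (auto simp: S_def bdd_above_def)
  define R where "R = Sup S"
  have R: "0 < R" "R \<le> T"
    using cSup_upper[OF \<open>min \<eta> T \<in> S\<close> bdd] cSup_least[OF ne, of T] \<eta>(1) T by (auto simp: R_def S_def)
  define \<G> where "\<G> = {(ball c \<rho>, g) |\<rho> g. 0 < \<rho> \<and> \<rho> \<le> T \<and> lifts f \<phi> (ball c \<rho>) g \<and> g c = x0}"
  obtain G where G: "lifts f \<phi> (\<Union>(B, h)\<in>\<G>. B) G" "\<And>B h x. \<lbrakk>(B, h) \<in> \<G>; x \<in> B\<rbrakk> \<Longrightarrow> G x = h x"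
  proof (rule glue_lifts[of \<G>])
    show "open B \<and> lifts f \<phi> B h" if "(B, h) \<in> \<G>" for B h using that by (auto simp: \<G>_def)
    fix B h B' h' x assume *: "(B, h) \<in> \<G>" "(B', h') \<in> \<G>" "x \<in> B" "x \<in> B'"
    show "h x = h' x"
    proof (rule lifts_unique[of "B \<inter> B'" \<phi> h h' c])
      show "connected (B \<inter> B')" using * by (auto simp: \<G>_def intro!: convex_connected convex_Int)
      show "\<phi> z \<notin> singular_values f" if "z \<in> B \<inter> B'" for z
        using that * sing[of z] by (auto simp: \<G>_def)
    qed (use * in \<open>auto simp: \<G>_def intro: lifts_subset\<close>)
  qed blast
  have sub: "ball c R \<subseteq> (\<Union>(B, h)\<in>\<G>. B)"
  proof
    fix z assume "z \<in> ball c R"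
    then obtain \<rho> where \<rho>: "\<rho> \<in> S" "dist c z < \<rho>" using less_cSup_iff[OF ne bdd] by (auto simp: R_def)
    then obtain g where "(ball c \<rho>, g) \<in> \<G>" by (auto simp: S_def \<G>_def)
    then show "z \<in> (\<Union>(B, h)\<in>\<G>. B)" using \<rho>(2) by (intro UN_I[of "(ball c \<rho>, g)"]) auto
  qed
  have liftR: "lifts f \<phi> (ball c R) G" by (rule lifts_subset[OF G(1) sub])
  have "c \<in> (\<Union>(B, h)\<in>\<G>. B)" using R by (intro subsetD[OF sub]) simp
  then have "\<exists>B h. (B, h) \<in> \<G> \<and> c \<in> B" by auto
  then obtain B h where "(B, h) \<in> \<G>" "c \<in> B" by blast
  then have Gc: "G c = x0" using G(2)[of B h c] by (auto simp: \<G>_def)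
  have "R = T"
  proof (rule ccontr)
    assume "R \<noteq> T"
    then obtain R' h where h: "R < R'" "R' \<le> T" "lifts f \<phi> (ball c R') h" "h c = G c"
      using extend_lift[OF R(1) _ phi sing liftR] R by (metis order_less_le)
    then have "R' \<in> S" using R Gc by (auto simp: S_def)
    then show False using cSup_upper[OF _ bdd, of R'] h(1) by (simp add: R_def)
  qed
  then show ?thesis using that liftR Gc by simp
qed

end

section \<open>Orbits, the postsingular set and lifts through iterates\<close>

lemma iterate_finite_Suc: "iterate_finite f (Suc n) z \<longleftrightarrow> iterate_finite f n z \<and> \<not> is_pole f ((f ^^ n) z)"
  by (auto simp: iterate_finite_def less_Suc_eq)

lemma iterate_finite_0 [simp]: "iterate_finite f 0 z"
  by (simp add: iterate_finite_def)

lemma iterate_finite_mono: "iterate_finite f n z \<Longrightarrow> m \<le> n \<Longrightarrow> iterate_finite f m z"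
  by (auto simp: iterate_finite_def)

lemma singular_values_subset_postsingular_set: "singular_values f \<subseteq> postsingular_set f"
  unfolding postsingular_set_def using closure_subset by (fastforce intro: exI[of _ 0])

lemma postsingular_set_invariant:
  assumes "p \<in> postsingular_set f" "\<not> is_pole f p"
  shows "f p \<in> postsingular_set f"
proof -
  obtain n s where "p = (f ^^ n) s" "s \<in> closure (singular_values f)" "iterate_finite f n s"
    using assms(1) by (auto simp: postsingular_set_def)
  then show ?thesis
    unfolding postsingular_set_def using assms(2)
    by (intro CollectI exI[of _ "Suc n"] exI[of _ s]) (simp add: iterate_finite_Suc)
qed

lemma postsingular_set_invariant_iterate:
  assumes "iterate_finite f n x" "k \<le> n" "(f ^^ k) x \<in> postsingular_set f"
  shows "(f ^^ n) x \<in> postsingular_set f"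
  using assms(2,1)
proof (induction n rule: dec_induct)
  case base then show ?case using assms by simp
next
  case (step n)
  then show ?case by (simp add: iterate_finite_Suc postsingular_set_invariant)
qed

context nicely_meromorphic
begin

text \<open>The outermost \<open>f\<close> is lifted first. The intermediate lift \<open>g1\<close>
  again avoids \<open>postsingular_set f\<close>, since \<open>f\<close> maps the nonpoles of that
  set into it; so the induction hypothesis applies with \<open>g1\<close> in place of
  \<open>\<phi>\<close>.\<close>

lemma lift_iterate_on_ball:
  assumes "0 < T" "\<phi> holomorphic_on ball c T"
    and "\<And>z. z \<in> ball c T \<Longrightarrow> \<phi> z \<notin> postsingular_set f"
    and "iterate_finite f n x0" "(f ^^ n) x0 = \<phi> c"
  obtains g where "g holomorphic_on ball c T" "g c = x0"
    "\<And>z. z \<in> ball c T \<Longrightarrow> iterate_finite f n (g z) \<and> (f ^^ n) (g z) = \<phi> z"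
  using assms(2-)
proof (induction n arbitrary: \<phi> thesis)
  case 0
  then show ?case by simp
next
  case (Suc n)
  have x0: "iterate_finite f n x0" "\<not> is_pole f ((f ^^ n) x0)" "f ((f ^^ n) x0) = \<phi> c"
    using Suc.prems by (auto simp: iterate_finite_Suc)
  have "\<phi> z \<notin> singular_values f" if "z \<in> ball c T" for z
    using Suc.prems(3)[OF that] singular_values_subset_postsingular_set by blast
  then obtain g1 where g1: "lifts f \<phi> (ball c T) g1" "g1 c = (f ^^ n) x0"
    using lift_on_ball[OF assms(1) Suc.prems(2) _ x0(2,3)] by metis
  have np: "g1 z \<notin> postsingular_set f" if "z \<in> ball c T" for z
    using postsingular_set_invariant[of "g1 z" f] g1(1) Suc.prems(3)[OF that] that by (auto simp: lifts_def)
  have hol: "g1 holomorphic_on ball c T" using g1 by (simp add: lifts_def)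
  obtain g where g: "g holomorphic_on ball c T" "g c = x0"
    "\<And>z. z \<in> ball c T \<Longrightarrow> iterate_finite f n (g z) \<and> (f ^^ n) (g z) = g1 z"
    using Suc.IH[OF _ hol np x0(1) g1(2)[symmetric]] by metis
  show ?case
    by (rule Suc.prems(1)[OF g(1,2)]) (use g(3) g1(1) in \<open>auto simp: lifts_def iterate_finite_Suc\<close>)
qed

end

section \<open>The case of a single exceptional point\<close>

text \<open>
  Here \<open>f\<close> covers the punctured plane by itself, so it should be a power.  An inverse branch on the
  disc around \<open>f x\<close> reaching to \<open>p\<close> is injective and omits \<open>p\<close>, so no two values of its square root
  around \<open>p\<close> are opposite; thus Schottky's theorem bounds the derivative of that branch.
\<close>

context nicely_meromorphic
begin

lemma single_exceptional_point_deriv_bound: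
  assumes sing: "singular_values f \<subseteq> {p}"
    and np: "\<And>x. \<not> is_pole f x" and pre: "\<And>x. f x = p \<longleftrightarrow> x = p"
  obtains C where "\<And>x. x \<noteq> p \<Longrightarrow> norm (f x - p) \<le> C * (norm (x - p) * norm (deriv f x))"
proof -
  have "cball 0 (1/2) \<subseteq> ball (0::complex) 1" by auto
  then obtain B where B: "\<And>h z. \<lbrakk>h holomorphic_on ball 0 1; \<And>x. x \<in> ball 0 1 \<Longrightarrow> h x \<noteq> 0 \<and> h x \<noteq> 1;
                     norm (h 0) \<le> 1; z \<in> cball 0 (1/2)\<rbrakk> \<Longrightarrow> norm (h z) \<le> B"
    using Schottky_bound_on_ball[of 1 "cball 0 (1/2)" 0 1] by (metis compact_cball zero_less_one)
  show ?thesis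
  proof (rule that)
    fix x assume x: "x \<noteq> p"
    define R where "R = f x - p"
    have R: "R \<noteq> 0" using pre x by (simp add: R_def)
    \<comment> \<open>The unit disc goes to the disc about \<open>f x\<close> that has
      \<open>p\<close> on its boundary, as the image of \<open>-1\<close>.\<close>
    define \<phi> where "\<phi> = (\<lambda>y. f x + R * y)"
    have phi_hol: "\<phi> holomorphic_on ball 0 1" unfolding \<phi>_def by (intro holomorphic_intros)
    have phi_p: "\<phi> y \<noteq> p" if "y \<in> ball 0 1" for y
    proof
      assume "\<phi> y = p"
      then have "R * (y + 1) = 0" by (simp add: \<phi>_def R_def algebra_simps)
      then have "y = -1" using R by (simp add: eq_neg_iff_add_eq_0)
      then show False using that by simp
    qed
    obtain g where g: "lifts f \<phi> (ball 0 1) g" "g 0 = x"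
      by (rule lift_on_ball[of 1 \<phi> 0 x]) (use phi_hol phi_p sing np in \<open>auto simp: \<phi>_def\<close>)
    have g_hol: "g holomorphic_on ball 0 1" and fg: "\<And>y. y \<in> ball 0 1 \<Longrightarrow> f (g y) = \<phi> y"
      using g by (auto simp: lifts_def)
    have inj: "y = y'" if "g y = g y'" "y \<in> ball 0 1" "y' \<in> ball 0 1" for y y'
    proof -
      have "\<phi> y = \<phi> y'" using fg[OF that(2)] fg[OF that(3)] that(1) by metis
      then show ?thesis using R by (simp add: \<phi>_def)
    qed
    have gp: "g y - p \<noteq> 0" if "y \<in> ball 0 1" for y
    proof
      assume "g y - p = 0"
      then have "g y = p" by simp
      then have "f (g y) = p" using pre by blast
      then show False using fg[OF that] phi_p[OF that] by metis
    qed
    have "(\<lambda>y. g y - p) holomorphic_on ball 0 1" by (intro holomorphic_intros g_hol)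
    then obtain s where s: "s holomorphic_on ball 0 1" "\<And>y. y \<in> ball 0 1 \<Longrightarrow> g y - p = s y ^ 2"
      using contractible_imp_holomorphic_sqrt[of "\<lambda>y. g y - p" "ball 0 1"] gp
        convex_imp_contractible[OF convex_ball[of "0::complex" 1]] by metis
    have s0: "s 0 \<noteq> 0" using s(2)[of 0] gp[of 0] by auto
    \<comment> \<open>Normalised to \<open>k 0 = -1\<close>. The value 1 would mean
      \<open>s y = - s 0\<close>, hence \<open>g y = g 0\<close>, so \<open>y = 0\<close> by
      injectivity and \<open>s 0 = 0\<close>, which is excluded.\<close>
    define k where "k = (\<lambda>y. - s y / s 0)"
    have k_hol: "k holomorphic_on ball 0 1" unfolding k_def using s0 by (intro holomorphic_intros s) auto
    have k01: "k y \<noteq> 0 \<and> k y \<noteq> 1" if y: "y \<in> ball 0 1" for y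
    proof
      show "k y \<noteq> 0" using s0 s(2)[OF y] gp[OF y] by (auto simp: k_def)
      show "k y \<noteq> 1"
      proof
        assume "k y = 1"
        then have "- s y = s 0" using s0 unfolding k_def by (metis divide_eq_1_iff)
        then have e: "s y = - s 0" by (metis minus_minus)
        then have "g y - p = g 0 - p" using s(2)[OF y] s(2)[of 0] by simp
        then have "g y = g 0" by simp
        then have "y = 0" using inj y by auto
        then show False using e s0 by simp
      qed
    qed
    have k0: "k 0 = -1" using s0 by (simp add: k_def)
    have gk: "g y = p + (x - p) * k y ^ 2" if y: "y \<in> ball 0 1" for y
    proof -
      have "(x - p) * k y ^ 2 = s 0 ^ 2 * k y ^ 2" using s(2)[of 0] g(2) by simp
      also have "\<dots> = s y ^ 2" using s0 by (simp add: k_def power_divide)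
      finally show ?thesis using s(2)[OF y] by (simp add: algebra_simps)
    qed
    have kB: "norm (k y) \<le> B" if "y \<in> cball 0 (1/2)" for y
      by (rule B[OF k_hol k01 _ that]) (simp_all add: k0)
    have "norm ((deriv ^^ 1) k 0) \<le> fact 1 * B / (1/2) ^ 1"
    proof (rule Cauchy_inequality)
      show "k holomorphic_on ball 0 (1/2)" by (rule holomorphic_on_subset[OF k_hol]) auto
      show "continuous_on (cball 0 (1/2)) k"
        by (rule continuous_on_subset[OF holomorphic_on_imp_continuous_on[OF k_hol]]) auto
      show "norm (k y) \<le> B" if "norm (0 - y) = 1/2" for y using kB[of y] that by simp
    qed simp
    then have k': "norm (deriv k 0) \<le> 2 * B" by simp
    have kd: "(k has_field_derivative deriv k 0) (at 0)"
      by (rule holomorphic_derivI[OF k_hol open_ball]) simp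
    \<comment> \<open>\<open>w\<close> coincides with \<open>g\<close> on the disc; differentiating
      \<open>f (w y) = \<phi> y\<close> at 0 expresses \<open>R\<close> through
      \<open>deriv f x\<close> and the bounded \<open>deriv k 0\<close>.\<close>
    define w where "w = (\<lambda>y. p + (x - p) * k y ^ 2)"
    have wd: "(w has_field_derivative - (2 * ((x - p) * deriv k 0))) (at 0)"
      unfolding w_def by (rule derivative_eq_intros kd refl)+ (simp add: k0 algebra_simps)
    have w0: "w 0 = x" by (simp add: w_def k0)
    have fd: "(f has_field_derivative deriv f x) (at (w 0))"
      unfolding w0 by (rule holomorphic_derivI[OF holomorphic_on_nonpoles open_nonpoles]) (simp add: np)
    have "((\<lambda>y. f (w y)) has_field_derivative deriv f x * (- (2 * ((x - p) * deriv k 0)))) (at 0)"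
      by (rule DERIV_chain2[OF fd wd])
    moreover have "((\<lambda>y. f (w y)) has_field_derivative R) (at 0)"
    proof (rule has_field_derivative_transform_within_open)
      show "(\<phi> has_field_derivative R) (at 0)" unfolding \<phi>_def by (rule derivative_eq_intros refl)+ simp
      show "\<phi> y = f (w y)" if "y \<in> ball 0 1" for y using fg[OF that] gk[OF that] by (simp add: w_def)
    qed auto
    ultimately have "R = deriv f x * (- (2 * ((x - p) * deriv k 0)))" by (rule DERIV_unique[symmetric])
    then have "norm R = norm (deriv f x) * (2 * norm (x - p) * norm (deriv k 0))"
      by (simp only: norm_mult norm_minus_cancel norm_numeral mult.assoc)
    also have "\<dots> \<le> norm (deriv f x) * (2 * norm (x - p) * (2 * B))"
      using k' by (intro mult_left_mono) auto
    finally show "norm (f x - p) \<le> 4 * B * (norm (x - p) * norm (deriv f x))"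
      by (simp add: R_def algebra_simps)
  qed
qed

text \<open>By the derivative bound the quotient \<open>Q\<close> is bounded, so its extension over
  \<open>p\<close> is constant by Liouville. The resulting differential equation forces
  \<open>f x - p\<close> to be a multiple of an integer power of \<open>x - p\<close>, which has no
  essential singularity at infinity.\<close>

lemma single_exceptional_point_imp_not_essential:
  assumes sing: "singular_values f \<subseteq> {p}"
    and np: "\<And>x. \<not> is_pole f x" and pre: "\<And>x. f x = p \<longleftrightarrow> x = p"
  shows "not_essential (\<lambda>w. f (1 / w)) 0"
proof -
  obtain C where C: "\<And>x. x \<noteq> p \<Longrightarrow> norm (f x - p) \<le> C * (norm (x - p) * norm (deriv f x))"
    using single_exceptional_point_deriv_bound[OF assms] by metis
  have f_hol: "f holomorphic_on UNIV" using holomorphic_on_nonpoles np by simp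
  have fd: "(f has_field_derivative deriv f x) (at x)" for x
    by (rule holomorphic_derivI[OF f_hol]) auto
  have d0: "deriv f x \<noteq> 0" if "x \<noteq> p" for x
    using deriv_nonzero[OF np] sing pre[of x] that by auto
  define Q where "Q = (\<lambda>x. (f x - p) / ((x - p) * deriv f x))"
  have Q_hol: "Q holomorphic_on UNIV - {p}"
    unfolding Q_def using d0 
    by (intro holomorphic_intros holomorphic_on_subset[OF f_hol] holomorphic_on_subset[OF holomorphic_deriv[OF f_hol]]) auto
  have Q_bd: "norm (Q x) \<le> C" if "x \<noteq> p" for x
    using C[OF that] d0[OF that] that by (simp add: Q_def norm_divide norm_mult pos_divide_le_eq)
  have "\<exists>B. eventually (\<lambda>z. norm (Q z) \<le> B) (at p)"
    using Q_bd by (intro exI[of _ C]) (auto simp: eventually_at intro!: exI[of _ 1])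
  then obtain q where q: "q holomorphic_on UNIV" "\<And>z. z \<noteq> p \<Longrightarrow> q z = Q z"
    using holomorphic_on_extend_bounded[OF Q_hol] by auto
  have "bounded (range q)"
    by (rule boundedI[of _ "max C (norm (q p))"]) (use q(2) Q_bd in \<open>force simp: le_max_iff_disj\<close>)
  then obtain c where c: "\<And>z. q z = c"
    using Liouville_theorem[OF q(1)] by (auto simp: constant_on_def)
  have eq: "f x - p = c * ((x - p) * deriv f x)" if "x \<noteq> p" for x
  proof -
    have "Q x = c" using q(2)[OF that] c by simp
    then show ?thesis using d0[OF that] that by (simp add: Q_def field_simps)
  qed
  have c0: "c \<noteq> 0" using eq[of "p + 1"] pre[of "p + 1"] by auto
  txt \<open>The equation \<open>f x - p = c (x - p) f' x\<close> is linear in the coordinate \<open>w = Ln (x - p)\<close>;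
    periodicity in \<open>w\<close> then makes \<open>1 / c\<close> an integer.\<close>
  define u where "u = (\<lambda>w. (f (p + exp w) - p) * exp (- w / c))"
  have "(u has_field_derivative 0) (at w)" for w
  proof -
    have "((\<lambda>w. f (p + exp w)) has_field_derivative deriv f (p + exp w) * exp w) (at w)"
      by (rule DERIV_chain2[OF fd]) (auto intro!: derivative_eq_intros)
    then have "(u has_field_derivative
        deriv f (p + exp w) * exp w * exp (- w / c) + (f (p + exp w) - p) * (exp (- w / c) * (- 1 / c))) (at w)"
      unfolding u_def using c0 by (auto intro!: derivative_eq_intros)
    moreover have "(f (p + exp w) - p) * (exp (- w / c) * (- 1 / c)) = - (deriv f (p + exp w) * exp w * exp (- w / c))"
      using eq[of "p + exp w"] c0 by simp
    ultimately show ?thesis by simp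
  qed
  then obtain a where a: "\<And>w. u w = a"
    using has_field_derivative_zero_constant[of UNIV u] by auto
  have f_exp: "f (p + exp w) - p = a * exp (w / c)" for w
  proof -
    have "f (p + exp w) - p = u w * exp (w / c)" by (simp add: u_def exp_minus)
    then show ?thesis by (simp add: a)
  qed
  have "a \<noteq> 0" using f_exp[of 0] pre[of "p + 1"] by auto
  \<comment> \<open>The arguments 0 and \<open>2 * of_real pi * \<i>\<close> of \<open>f_exp\<close>
    belong to the same point \<open>p + 1\<close>.\<close>
  then have "exp (2 * of_real pi * \<i> / c) = 1" using f_exp[of 0] f_exp[of "2 * of_real pi * \<i>"] by simp
  then obtain n :: int where n: "2 * of_real pi * \<i> / c = of_int (2 * n) * of_real pi * \<i>"
    unfolding exp_eq_1 by (metis complex_eq of_real_mult of_real_of_int_eq add.left_neutral mult.commute of_real_0)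
  then have "1 / c = of_int n" using c0 by (simp add: field_simps)
  have f_pow: "f x = p + a * (x - p) powi n" if "x \<noteq> p" for x
  proof -
    define w where "w = Ln (x - p)"
    have x: "x = p + exp w" using that by (simp add: w_def)
    have "exp (w / c) = exp (of_int n * w)" using \<open>1 / c = of_int n\<close> by (metis divide_inverse mult.commute mult_1)
    also have "\<dots> = (x - p) powi n" using x by (simp add: exp_power_int mult.commute)
    finally show ?thesis using f_exp[of w] x by (simp add: algebra_simps)
  qed
  have "(\<lambda>w. p + a * (1 / w - p) powi n) meromorphic_on {0}"
    by (intro meromorphic_intros)
  then have "not_essential (\<lambda>w. p + a * (1 / w - p) powi n) 0"
    unfolding meromorphic_at_iff by blast
  moreover have "\<forall>\<^sub>F w in at 0. f (1 / w) = p + a * (1 / w - p) powi n"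
  proof -
    have "filterlim (\<lambda>w::complex. 1 / w) at_infinity (at 0)"
      using filterlim_inverse_at_infinity by (simp add: inverse_eq_divide [abs_def])
    \<comment> \<open>This keeps \<open>1 / w\<close> away from \<open>p\<close>, where
      \<open>f_pow\<close> says nothing.\<close>
    then have "\<forall>\<^sub>F w::complex in at 0. norm p + 1 \<le> norm (1 / w)"
      unfolding filterlim_at_infinity[OF order.refl] by (rule allE[of _ "norm p + 1"]) (simp add: add_nonneg_pos)
    then show ?thesis by eventually_elim (rule f_pow, auto)
  qed
  ultimately show ?thesis
    using not_essential_cong[of "\<lambda>w. f (1 / w)" "\<lambda>w. p + a * (1 / w - p) powi n" 0 0] by simp
qed

end

section \<open>The Fatou set\<close>

lemma open_fatou_set: "open (fatou_set f)"
proof (subst open_subopen, intro ballI)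
  fix z assume "z \<in> fatou_set f"
  then obtain V where "open V" "z \<in> V" "\<forall>n>0. \<forall>w\<in>V. iterate_defined f n w"
    "normal_family_on V {sphere_iterate f n | n. n > 0}"
    unfolding fatou_set_def by auto
  then show "\<exists>T. open T \<and> z \<in> T \<and> T \<subseteq> fatou_set f" unfolding fatou_set_def by blast
qed

lemma fatou_set_iterate_finite: "z \<in> fatou_set f \<Longrightarrow> iterate_finite f n z"
  unfolding fatou_set_def iterate_defined_def by blast

lemma fatou_set_not_pole: "z \<in> fatou_set f \<Longrightarrow> \<not> is_pole f z"
  using fatou_set_iterate_finite[of z f 1] by (simp add: iterate_finite_def)

lemma iterate_finite_Suc_shift: "iterate_finite f (Suc n) z \<longleftrightarrow> \<not> is_pole f z \<and> iterate_finite f n (f z)"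
proof -
  have "(f ^^ k) (f z) = (f ^^ Suc k) z" for k by (simp add: funpow_swap1)
  then show ?thesis unfolding iterate_finite_def by (metis (no_types, lifting) less_Suc_eq_0_disj funpow_0)
qed

lemma sphere_iterate_Suc_shift:
  assumes "\<not> is_pole f z"
  shows "sphere_iterate f (Suc n) z = sphere_iterate f n (f z)"
proof -
  have "(f ^^ n) (f z) = (f ^^ Suc n) z" by (simp add: funpow_swap1)
  then show ?thesis using assms by (simp add: sphere_iterate_def iterate_finite_Suc_shift)
qed

text \<open>Otherwise there are points \<open>v m\<close> tending to \<open>g b\<close> that are
  omitted by \<open>s (k m)\<close>, with \<open>k m\<close> going to infinity. The zero-free
  functions \<open>s (k m) z - v m\<close> converge to \<open>g z - g b\<close>, which is not
  constant but vanishes at \<open>b\<close>, against Hurwitz's theorem.\<close>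

lemma Hurwitz_ball_subset_image:
  assumes D: "open D" "connected D"
    and hol: "\<And>n::nat. s n holomorphic_on D" "g holomorphic_on D"
    and lim: "\<And>K. \<lbrakk>compact K; K \<subseteq> D\<rbrakk> \<Longrightarrow> uniform_limit K s g sequentially"
    and nonconst: "\<not> g constant_on D" and b: "b \<in> D"
  obtains c N where "c > 0" "\<And>n. n \<ge> N \<Longrightarrow> ball (g b) c \<subseteq> s n ` D"
proof (rule ccontr)
  assume "\<not> thesis"
  then have "\<And>c N. c > 0 \<Longrightarrow> \<exists>n\<ge>N. \<not> ball (g b) c \<subseteq> s n ` D" using that by blast
  then have "\<exists>n\<ge>m. \<exists>v. v \<in> ball (g b) (1 / real (Suc m)) \<and> v \<notin> s n ` D" for m
    by (metis of_nat_0_less_iff subsetI zero_less_Suc zero_less_divide_1_iff)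
  then obtain k v where k: "\<And>m. k m \<ge> m"
      and v: "\<And>m. v m \<in> ball (g b) (1 / real (Suc m))" "\<And>m. v m \<notin> s (k m) ` D"
    by metis
  have k_lim: "filterlim k at_top sequentially"
    by (rule filterlim_at_top_mono[OF filterlim_ident]) (use k in auto)
  have "(\<lambda>m. dist (v m) (g b)) \<longlonglongrightarrow> 0"
  proof (rule tendsto_sandwich[OF _ _ tendsto_const LIMSEQ_Suc[OF lim_1_over_n]]; intro always_eventually allI)
    show "dist (v m) (g b) \<le> 1 / real (Suc m)" for m using v(1)[of m] by (simp add: dist_commute)
  qed simp
  then have v_lim: "v \<longlonglongrightarrow> g b" by (rule tendsto_dist_iff[THEN iffD2])
  have "g b - g b \<noteq> 0"
  proof (rule Hurwitz_no_zeros[where \<F> = "\<lambda>m z. s (k m) z - v m" and g = "\<lambda>z. g z - g b", OF D])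
    show "(\<lambda>z. s (k m) z - v m) holomorphic_on D" for m by (intro holomorphic_intros hol)
    show "(\<lambda>z. g z - g b) holomorphic_on D" by (intro holomorphic_intros hol)
    show "\<not> (\<lambda>z. g z - g b) constant_on D"
      using nonconst unfolding constant_on_def by (metis diff_add_cancel)
    show "s (k m) z - v m \<noteq> 0" if "z \<in> D" for m z using v(2)[of m] that by force
    show "uniform_limit K (\<lambda>m z. s (k m) z - v m) (\<lambda>z. g z - g b) sequentially" if K: "compact K" "K \<subseteq> D" for K
    proof (rule uniform_limit_minus)
      show "uniform_limit K (\<lambda>m. s (k m)) g sequentially"
        using lim[OF K] k_lim by (rule filterlim_compose)
      show "uniform_limit K (\<lambda>m z. v m) (\<lambda>z. g b) sequentially"
        using v_lim by (auto simp: uniform_limit_iff tendsto_iff elim: eventually_mono)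
    qed
  qed (rule b)
  then show False by simp
qed

text \<open>A Riemann map of the \<open>\<epsilon>\<close>-neighbourhood of the segment from 0 to 1.
  Writing this neighbourhood as a sum of the segment and a disc shows that it is convex, hence
  simply connected, and open.\<close>

lemma holomorphic_map_into_segment_nhd:
  assumes "0 < \<epsilon>"
  obtains \<psi> b where "\<psi> holomorphic_on ball 0 1" "\<psi> 0 = 0" "b \<in> ball 0 1" "\<psi> b = (1::complex)"
    "\<And>y. y \<in> ball 0 1 \<Longrightarrow> \<exists>t. 0 \<le> t \<and> t \<le> 1 \<and> norm (\<psi> y - of_real t) < \<epsilon>"
proof -
  define C where "C = (\<Union>x\<in>closed_segment 0 (1::complex). \<Union>y\<in>ball 0 \<epsilon>. {x + y})"
  have "convex C" unfolding C_def by (intro convex_sums convex_ball convex_closed_segment)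
  moreover have "open C" unfolding C_def by (intro open_sums) auto
  moreover have C_bd: "norm x \<le> 1 + \<epsilon>" if "x \<in> C" for x
  proof -
    obtain u v where "u \<in> closed_segment 0 1" "norm v < \<epsilon>" "x = u + v" using \<open>x \<in> C\<close> by (auto simp: C_def)
    moreover have "norm u \<le> 1" using segment_bound(1)[OF \<open>u \<in> closed_segment 0 1\<close>] by simp
    ultimately show ?thesis using norm_triangle_ineq[of u v] by simp
  qed
  \<comment> \<open>A point outside \<open>C\<close>, since the Riemann mapping theorem excludes the
    whole plane.\<close>
  have "of_real (2 + \<epsilon>) \<notin> C" using C_bd[of "of_real (2 + \<epsilon>)"] assms by (auto simp del: of_real_add)
  then have "C \<noteq> UNIV" by blast
  moreover have inC: "0 \<in> C" "1 \<in> C" using assms by (force simp: C_def)+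
  ultimately obtain F G where FG: "F holomorphic_on C" "G holomorphic_on ball 0 1"
      "\<And>z. z \<in> C \<Longrightarrow> F z \<in> ball 0 1 \<and> G (F z) = z" "\<And>z. z \<in> ball 0 1 \<Longrightarrow> G z \<in> C \<and> F (G z) = z"
    using Riemann_mapping_theorem[of C] convex_imp_simply_connected[of C] by blast
  \<comment> \<open>An automorphism of the disc moving \<open>F 0\<close> to the centre, with
    inverse \<open>q\<close>, normalises the Riemann map.\<close>
  obtain p q where pq: "p (F 0) = 0" "q holomorphic_on ball 0 1" "q ` ball 0 1 \<subseteq> ball 0 1"
     "p ` ball 0 1 \<subseteq> ball 0 1" "\<And>z. z \<in> ball 0 1 \<Longrightarrow> q (p z) = z"
    using ball_biholomorphism_exists[of "F 0"] FG(3)[OF inC(1)] by metis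
  show ?thesis
  proof (rule that[of "G \<circ> q" "p (F 1)"])
    show "G \<circ> q holomorphic_on ball 0 1" by (rule holomorphic_on_compose_gen[OF pq(2) FG(2) pq(3)])
    show "(G \<circ> q) 0 = 0" using pq(5)[of "F 0"] pq(1) FG(3)[OF inC(1)] by simp
    show "p (F 1) \<in> ball 0 1" using pq(4) FG(3)[OF inC(2)] by blast
    show "(G \<circ> q) (p (F 1)) = 1" using pq(5)[of "F 1"] FG(3)[OF inC(2)] by simp
    fix y :: complex assume "y \<in> ball 0 1"
    then have "G (q y) \<in> C" using pq(3) FG(4) by blast
    then obtain u v where "u \<in> closed_segment 0 1" "norm v < \<epsilon>" "G (q y) = u + v" by (auto simp: C_def)
    moreover then obtain t where "0 \<le> t" "t \<le> 1" "u = of_real t" by (auto simp: closed_segment_def scaleR_conv_of_real)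
    ultimately show "\<exists>t. 0 \<le> t \<and> t \<le> 1 \<and> norm ((G \<circ> q) y - of_real t) < \<epsilon>"
      by (intro exI[of _ t]) simp
  qed
qed

section \<open>Forward invariance and a criterion for Fatou points\<close>

context nicely_meromorphic
begin

text \<open>Near \<open>f z\<close> the \<open>n\<close>-th iterate is the \<open>Suc n\<close>-th
  iterate composed with a local inverse \<open>h\<close> of \<open>f\<close>, so normality near
  \<open>z\<close> carries over to a neighbourhood of \<open>f z\<close>.\<close>

lemma fatou_set_forward:
  assumes z: "z \<in> fatou_set f" and d: "deriv f z \<noteq> 0"
  shows "f z \<in> fatou_set f"
proof -
  obtain V where V: "open V" "z \<in> V" "\<And>n w. n > 0 \<Longrightarrow> w \<in> V \<Longrightarrow> iterate_defined f n w"
    and norm: "normal_family_on V {sphere_iterate f n | n. n > 0}"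
    using z unfolding fatou_set_def by auto
  obtain r h where r: "0 < r" "\<And>z'. z' \<in> ball z r \<Longrightarrow> \<not> is_pole f z'" "f holomorphic_on ball z r"
    "inj_on f (ball z r)" "h holomorphic_on f ` ball z r" "\<And>z'. z' \<in> ball z r \<Longrightarrow> h (f z') = z'"
    using local_inverse[OF fatou_set_not_pole[OF z] d] by metis
  obtain \<rho> where \<rho>: "0 < \<rho>" "cball z \<rho> \<subseteq> V \<inter> ball z r"
  proof -
    \<comment> \<open>A compact disc is chosen inside \<open>V\<close>: the limit is uniform on it,
      and \<open>h\<close> maps all of \<open>W\<close> into it.\<close>
    have "open (V \<inter> ball z r)" "z \<in> V \<inter> ball z r" using V r(1) by auto
    then show ?thesis using that open_contains_cball by metis
  qed
  have sub: "ball z \<rho> \<subseteq> ball z r" using \<rho> ball_subset_cball by blast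
  define W where "W = f ` ball z \<rho>"
  have "open W" unfolding W_def
    by (rule open_mapping_thm3[OF holomorphic_on_subset[OF r(3) sub] open_ball inj_on_subset[OF r(4) sub]])
  moreover have "f z \<in> W" using \<rho> by (simp add: W_def)
  moreover have "iterate_defined f n w" if "w \<in> W" for n w
  proof -
    obtain v where v: "v \<in> ball z \<rho>" "w = f v" using \<open>w \<in> W\<close> by (auto simp: W_def)
    have "v \<in> V" using v \<rho> ball_subset_cball by blast
    then have "iterate_defined f (Suc n) v" using V(3) by blast
    then have "iterate_finite f (Suc k) v" if "k < n" for k using that by (simp add: iterate_defined_def)
    then show ?thesis using v by (simp add: iterate_defined_def iterate_finite_Suc_shift)
  qed
  moreover have "normal_family_on W {sphere_iterate f n | n. n > 0}"
  proof (rule normal_family_onI)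
    fix s :: "nat \<Rightarrow> complex \<Rightarrow> sphere" assume "range s \<subseteq> {sphere_iterate f n | n. n > 0}"
    then have "\<exists>m>0. s j = sphere_iterate f m" for j by blast
    then obtain m where m: "\<And>j. s j = sphere_iterate f (m j)" by metis
    have "range (\<lambda>j. sphere_iterate f (Suc (m j))) \<subseteq> {sphere_iterate f n | n. n > 0}" by blast
    then obtain k g where k: "strict_mono (k :: nat \<Rightarrow> nat)"
      and g: "\<And>K. compact K \<and> K \<subseteq> V \<Longrightarrow> uniform_limit K (\<lambda>j z. stereo (sphere_iterate f (Suc (m (k j))) z)) (\<lambda>z. stereo (g z)) sequentially"
      using norm unfolding normal_family_on_def by meson
    have lim: "uniform_limit (cball z \<rho>) (\<lambda>j z. stereo (sphere_iterate f (Suc (m (k j))) z)) (\<lambda>z. stereo (g z)) sequentially"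
      using g[of "cball z \<rho>"] \<rho> by auto
    have "uniform_limit K (\<lambda>j z. stereo (s (k j) z)) (\<lambda>z. stereo (g (h z))) sequentially" if "K \<subseteq> W" for K
    proof -
      have h: "h x \<in> cball z \<rho> \<and> \<not> is_pole f (h x) \<and> f (h x) = x" if "x \<in> K" for x
      proof -
        obtain v where v: "v \<in> ball z \<rho>" "x = f v" using \<open>x \<in> K\<close> \<open>K \<subseteq> W\<close> by (auto simp: W_def)
        then have "v \<in> ball z r" using sub by blast
        then show ?thesis using v r(2)[of v] r(6)[of v] by auto
      qed
      then have "h \<in> K \<rightarrow> cball z \<rho>" by blast
      from uniform_limit_compose'[OF lim this] show ?thesis
        by (rule uniform_limit_cong_on) (use h m in \<open>auto simp: sphere_iterate_Suc_shift\<close>)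
    qed
    then show "\<exists>(k :: nat \<Rightarrow> nat) g. strict_mono k \<and> (\<forall>K. compact K \<and> K \<subseteq> W \<longrightarrow>
              uniform_limit K (\<lambda>j z. stereo (s (k j) z)) (\<lambda>z. stereo (g z)) sequentially)"
      using k by (intro exI[of _ k] exI[of _ "\<lambda>z. g (h z)"]) blast
  qed
  ultimately show ?thesis unfolding fatou_set_def by blast
qed

text \<open>If the orbit is outside \<open>postsingular_set f\<close> at time \<open>n\<close>, it
  was outside at all earlier times, so it meets no critical point before time \<open>n\<close> and
  each step preserves the Fatou set. Read backwards, this makes preimages of Julia points under
  iterates Julia points.\<close>

lemma fatou_set_forward_iterate:
  assumes "z \<in> fatou_set f" "(f ^^ n) z \<notin> postsingular_set f"
  shows "(f ^^ n) z \<in> fatou_set f"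
  using assms(2)
proof (induction n)
  case 0
  then show ?case using assms by simp
next
  case (Suc n)
  have "iterate_finite f (Suc n) z" using assms(1) by (rule fatou_set_iterate_finite)
  then have "(f ^^ n) z \<notin> postsingular_set f"
    using postsingular_set_invariant_iterate[of f "Suc n" z n] Suc.prems by auto
  then have F: "(f ^^ n) z \<in> fatou_set f" by (rule Suc.IH)
  have "f ((f ^^ n) z) \<notin> singular_values f" using Suc.prems singular_values_subset_postsingular_set by auto
  then have "deriv f ((f ^^ n) z) \<noteq> 0" using deriv_nonzero fatou_set_not_pole[OF F] by blast
  then show ?case using fatou_set_forward[OF F] by simp
qed

lemma holomorphic_on_iterate:
  assumes "\<And>z. z \<in> D \<Longrightarrow> iterate_finite f n z"
  shows "f ^^ n holomorphic_on D"
  using assms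
proof (induction n)
  case 0
  then show ?case by (simp add: holomorphic_on_ident id_def)
next
  case (Suc n)
  then have "f ^^ n holomorphic_on D" "(f ^^ n) ` D \<subseteq> {z. \<not> is_pole f z}"
    by (auto simp: iterate_finite_Suc)
  then show ?case using holomorphic_on_compose_gen[OF _ holomorphic_on_nonpoles, of "f ^^ n" D] by (simp add: o_def)
qed

lemma fatou_setI_omitting_two_values:
  assumes "0 < R" "a \<noteq> b"
    and "\<And>n x. x \<in> ball w R \<Longrightarrow> iterate_finite f n x"
    and "\<And>n x. x \<in> ball w R \<Longrightarrow> (f ^^ n) x \<noteq> a \<and> (f ^^ n) x \<noteq> b"
  shows "w \<in> fatou_set f"
proof -
  have "normal_family_on (ball w R) {sphere_iterate f n | n. n > 0}"
  proof (rule Montel_omitting_two_values[OF assms(1,2)])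
    fix s assume "s \<in> {sphere_iterate f n | n. n > 0}"
    then obtain n where "s = sphere_iterate f n" by blast
    then show "\<exists>h. h holomorphic_on ball w R \<and> (\<forall>x\<in>ball w R. h x \<noteq> a \<and> h x \<noteq> b \<and> s x = Some (h x))"
      using assms(3,4) holomorphic_on_iterate[of "ball w R" n]
      by (intro exI[of _ "f ^^ n"]) (auto simp: sphere_iterate_def)
  qed
  then show ?thesis
    unfolding fatou_set_def using assms(1,3)
    by (intro CollectI exI[of _ "ball w R"]) (auto simp: iterate_defined_def)
qed

end

section \<open>Topologically hyperbolic maps\<close>

locale topologically_hyperbolic_map =
  fixes f :: "complex \<Rightarrow> complex"
  assumes topologically_hyperbolic: "topologically_hyperbolic f"

sublocale topologically_hyperbolic_map \<subseteq> nicely_meromorphic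
  using topologically_hyperbolic
  by unfold_locales (simp add: topologically_hyperbolic_def transcendental_meromorphic_def)

context topologically_hyperbolic_map
begin

lemma setdist_postsingular_julia_pos: "setdist (postsingular_set f) (- fatou_set f) > 0"
  using topologically_hyperbolic by (simp add: topologically_hyperbolic_def finite_julia_set_def)

lemma not_fatou_not_postsingular: "x \<notin> fatou_set f \<Longrightarrow> x \<notin> postsingular_set f"
  using setdist_le_dist[of x "postsingular_set f" x "- fatou_set f"] setdist_postsingular_julia_pos by auto

text \<open>Poles and one-step preimages are added so that two points are available even when
  \<open>postsingular_set f\<close> is a singleton. An orbit that is finite and outside
  \<open>postsingular_set f\<close> at time \<open>n\<close> avoids the larger set before time
  \<open>n\<close>.\<close>

definition exceptional_set :: "complex set" where
  "exceptional_set = postsingular_set f \<union> {x. is_pole f x} \<union> {x. f x \<in> postsingular_set f}"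

text \<open>If the set were a single point \<open>p\<close>, then \<open>f\<close> would be entire,
  \<open>p\<close> would be its own only preimage, and no other finite singular value would exist;
  such an \<open>f\<close> is not transcendental.\<close>

lemma exceptional_set_two_points: obtains a b where "a \<in> exceptional_set" "b \<in> exceptional_set" "a \<noteq> b"
proof (rule ccontr)
  assume no: "\<not> thesis"
  have eq: "x = y" if "x \<in> exceptional_set" "y \<in> exceptional_set" for x y
    by (rule ccontr) (use no that \<open>\<And>a b. \<lbrakk>a \<in> exceptional_set; b \<in> exceptional_set; a \<noteq> b\<rbrakk> \<Longrightarrow> thesis\<close> in blast)
  have "postsingular_set f \<noteq> {}" using setdist_postsingular_julia_pos by auto
  then obtain p where p: "p \<in> postsingular_set f" by blast
  have single: "x = p" if "x \<in> exceptional_set" for x using eq[OF that, of p] p by (simp add: exceptional_set_def)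
  \<comment> \<open>Hyperbolicity puts \<open>postsingular_set f\<close> inside the Fatou set, which
    contains no poles.\<close>
  have "\<not> is_pole f p" using p fatou_set_not_pole not_fatou_not_postsingular by blast
  then have np: "\<not> is_pole f x" for x using single[of x] by (auto simp: exceptional_set_def)
  have "f p \<in> postsingular_set f" using postsingular_set_invariant[OF p] np by blast
  then have fp: "f p = p" using single[of "f p"] by (simp add: exceptional_set_def)
  have "f x = p \<longleftrightarrow> x = p" for x using fp p single[of x] by (auto simp: exceptional_set_def)
  moreover have "singular_values f \<subseteq> {p}"
    using single singular_values_subset_postsingular_set[of f] by (auto simp: exceptional_set_def)
  ultimately have "not_essential (\<lambda>w. f (1 / w)) 0"
    using single_exceptional_point_imp_not_essential np by blast
  then show False
    using topologically_hyperbolic by (simp add: topologically_hyperbolic_def transcendental_meromorphic_def)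
qed

lemma iterate_avoids_exceptional_set:
  assumes "iterate_finite f n x" "(f ^^ n) x \<notin> postsingular_set f" "k < n"
  shows "(f ^^ k) x \<notin> exceptional_set"
proof -
  have "\<not> is_pole f ((f ^^ k) x)" using assms by (simp add: iterate_finite_def)
  moreover have "(f ^^ k) x \<notin> postsingular_set f"
    using postsingular_set_invariant_iterate[OF assms(1), of k] assms by auto
  moreover have "(f ^^ Suc k) x \<notin> postsingular_set f"
    using postsingular_set_invariant_iterate[OF assms(1), of "Suc k"] assms by auto
  ultimately show ?thesis by (simp add: exceptional_set_def)
qed

text \<open>The segment from \<open>x\<close> to \<open>p\<close> leaves \<open>V\<close> through a
  boundary point, which is a Julia point. So the lower bound for distances from Julia points to
  \<open>postsingular_set f\<close> also holds for points of \<open>V\<close>.\<close>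

lemma dist_component_postsingular:
  assumes V: "V \<in> components (fatou_set f)" "V \<inter> postsingular_set f = {}"
    and "x \<in> V" "p \<in> postsingular_set f"
  shows "setdist (postsingular_set f) (- fatou_set f) \<le> dist x p"
proof -
  have "closed_segment x p \<inter> frontier V \<noteq> {}"
    by (rule connected_Int_frontier) (use assms in auto)
  then obtain y where y: "y \<in> closed_segment x p" "y \<in> frontier V" by blast
  have "y \<in> frontier (fatou_set f)" using frontier_of_components_subset[OF V(1)] y by blast
  then have "y \<in> - fatou_set f" using open_fatou_set frontier_disjoint_eq by blast
  then have "setdist (postsingular_set f) (- fatou_set f) \<le> dist p y"
    using assms(4) by (rule setdist_le_dist[rotated])
  also have "\<dots> \<le> dist x p" using dist_in_closed_segment[OF y(1)] by (simp add: dist_commute)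
  finally show ?thesis .
qed

text \<open>The affine copy \<open>\<phi>\<close> of \<open>\<psi>\<close> sends 0 to
  \<open>(f ^^ n) z\<close> and \<open>b\<close> to a nearest boundary point \<open>w\<close>. Its
  values are closer than \<open>\<delta>\<close> to the segment between these points, whose distance
  from \<open>postsingular_set f\<close> is at least \<open>\<delta>\<close>; so
  \<open>\<phi>\<close> lifts through \<open>f ^^ n\<close>.\<close>

lemma large_ball_lift:
  assumes \<psi>: "\<psi> holomorphic_on ball 0 1" "\<psi> 0 = 0" "b \<in> ball 0 1" "\<psi> b = 1"
    "\<And>y. y \<in> ball 0 1 \<Longrightarrow> \<exists>t. 0 \<le> t \<and> t \<le> 1 \<and>
       norm (\<psi> y - of_real t) < setdist (postsingular_set f) (- fatou_set f) / r"
    and V: "V \<in> components (fatou_set f)" "V \<inter> postsingular_set f = {}"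
    and z: "z \<in> fatou_set f" "(f ^^ n) z \<in> V" and r: "r > 0" "\<not> ball ((f ^^ n) z) r \<subseteq> V"
  obtains G where "G holomorphic_on ball 0 1" "G 0 = z" "G b \<notin> fatou_set f"
    "\<And>y. y \<in> ball 0 1 \<Longrightarrow> iterate_finite f n (G y) \<and> (f ^^ n) (G y) \<notin> postsingular_set f"
proof -
  define x where "x = (f ^^ n) z"
  define \<delta> where "\<delta> = setdist (postsingular_set f) (- fatou_set f)"
  have Vopen: "open V" using V(1) open_components[OF open_fatou_set] by blast
  have "- V \<noteq> {}" using r by blast
  then obtain w where w: "w \<in> - V" "\<And>y. y \<in> - V \<Longrightarrow> dist x w \<le> dist x y"
    using distance_attains_inf[of "- V" x] Vopen by (auto simp: closed_Compl)
  have wr: "dist x w < r"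
  proof -
    obtain v where "v \<in> ball x r" "v \<notin> V" using r unfolding x_def by blast
    then show ?thesis using w(2)[of v] by simp
  qed
  have bV: "ball x (dist x w) \<subseteq> V" using w(2) by fastforce
  have "x \<in> V" using z by (simp add: x_def)
  then have xw: "x \<noteq> w" using w by blast
  have "w \<in> closure (ball x (dist x w))" using xw by simp
  then have "w \<in> closure V" using closure_mono[OF bV] by blast
  then have "w \<in> frontier V" using w(1) Vopen by (simp add: frontier_def interior_open)
  then have "w \<in> frontier (fatou_set f)" using frontier_of_components_subset[OF V(1)] by blast
  then have wJ: "w \<notin> fatou_set f" using open_fatou_set frontier_disjoint_eq by blast
  define \<phi> where "\<phi> = (\<lambda>y. x + (w - x) * \<psi> y)"
  have phi_hol: "\<phi> holomorphic_on ball 0 1" unfolding \<phi>_def by (intro holomorphic_intros \<psi>(1))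
  have phi_P: "\<phi> y \<notin> postsingular_set f" if y: "y \<in> ball 0 1" for y
  proof
    assume p: "\<phi> y \<in> postsingular_set f"
    obtain t where t: "0 \<le> t" "t \<le> 1" "norm (\<psi> y - of_real t) < \<delta> / r" using \<psi>(5)[OF y] by (auto simp: \<delta>_def)
    define u where "u = x + of_real t * (w - x)"
    \<comment> \<open>For \<open>t = 1\<close> the point \<open>u\<close> is the Julia point
      \<open>w\<close>, and \<open>\<delta>\<close> bounds the distance by definition; for smaller
      \<open>t\<close> it lies in \<open>V\<close>, where \<open>dist_component_postsingular\<close>
      applies.\<close>
    have "\<delta> \<le> dist u (\<phi> y)"
    proof (cases "t = 1")
      case True
      then have "u = w" by (simp add: u_def)
      then show ?thesis using setdist_le_dist[OF p, of w "- fatou_set f"] wJ by (simp add: \<delta>_def dist_commute)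
    next
      case False
      have "dist x u = t * dist x w" using t by (simp add: u_def dist_norm norm_mult norm_minus_commute)
      also have "\<dots> < 1 * dist x w" using t False xw by (intro mult_strict_right_mono) auto
      finally have "u \<in> V" using bV by auto
      then show ?thesis using dist_component_postsingular[OF V _ p] by (simp add: \<delta>_def)
    qed
    moreover have "dist u (\<phi> y) = dist x w * norm (\<psi> y - of_real t)"
    proof -
      have "\<phi> y - u = (w - x) * (\<psi> y - of_real t)" by (simp add: \<phi>_def u_def algebra_simps)
      then show ?thesis by (simp add: dist_norm norm_minus_commute[of u] norm_minus_commute[of x] norm_mult)
    qed
    moreover have "dist x w * norm (\<psi> y - of_real t) \<le> r * norm (\<psi> y - of_real t)"
      using wr by (intro mult_right_mono) auto
    moreover have "r * norm (\<psi> y - of_real t) < \<delta>" using t(3) r(1) by (simp add: pos_less_divide_eq mult.commute)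
    ultimately show False by linarith
  qed
  have "(f ^^ n) z = \<phi> 0" by (simp add: \<phi>_def \<psi>(2) x_def)
  then obtain G where G: "G holomorphic_on ball 0 1" "G 0 = z"
    "\<And>y. y \<in> ball 0 1 \<Longrightarrow> iterate_finite f n (G y) \<and> (f ^^ n) (G y) = \<phi> y"
    using lift_iterate_on_ball[of 1 \<phi> 0 n z] phi_hol phi_P fatou_set_iterate_finite[OF z(1)]
    by (metis zero_less_one)
  show ?thesis
  proof (rule that[OF G(1,2)])
    have "(f ^^ n) (G b) = w" using G(3)[OF \<psi>(3)] by (simp add: \<phi>_def \<psi>(4))
    then show "G b \<notin> fatou_set f"
      using fatou_set_forward_iterate[of "G b" n] wJ not_fatou_not_postsingular[OF wJ] by auto
    show "iterate_finite f n (G y) \<and> (f ^^ n) (G y) \<notin> postsingular_set f" if "y \<in> ball 0 1" for y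
      using G(3)[OF that] phi_P[OF that] by simp
  qed
qed

proposition eventually_large_ball_subset_component:
  assumes V: "\<And>n. V n \<in> components (fatou_set f)" "\<And>n. n > 0 \<Longrightarrow> V n \<inter> postsingular_set f = {}"
    and z: "z \<in> fatou_set f" "\<And>n. (f ^^ n) z \<in> V n" and r: "r > 0"
  shows "\<exists>n0. \<forall>n\<ge>n0. ball ((f ^^ n) z) r \<subseteq> V n"
proof (rule ccontr)
  assume "\<not> ?thesis"
  \<comment> \<open>With \<open>Suc\<close> the bad times satisfy \<open>m k > k\<close>: they are
    positive, as the hypothesis on \<open>V\<close> demands, and eventually exceed every given
    time.\<close>
  then have "\<forall>n0. \<exists>n. n \<ge> Suc n0 \<and> \<not> ball ((f ^^ n) z) r \<subseteq> V n" by blast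
  then obtain m where m: "\<And>k. m k \<ge> Suc k" "\<And>k. \<not> ball ((f ^^ m k) z) r \<subseteq> V (m k)" by metis
  have m0: "m k > 0" for k using m(1)[of k] by simp
  obtain \<psi> b where \<psi>: "\<psi> holomorphic_on ball 0 1" "\<psi> 0 = 0" "b \<in> ball 0 1" "\<psi> b = 1"
    "\<And>y. y \<in> ball 0 1 \<Longrightarrow> \<exists>t. 0 \<le> t \<and> t \<le> 1 \<and>
       norm (\<psi> y - of_real t) < setdist (postsingular_set f) (- fatou_set f) / r"
    using holomorphic_map_into_segment_nhd[of "setdist (postsingular_set f) (- fatou_set f) / r"]
      setdist_postsingular_julia_pos r by (metis divide_pos_pos)
  have "\<exists>G. G holomorphic_on ball 0 1 \<and> G 0 = z \<and> G b \<notin> fatou_set f \<and> (\<forall>y\<in>ball 0 1.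
      iterate_finite f (m k) (G y) \<and> (f ^^ m k) (G y) \<notin> postsingular_set f)" for k
    using large_ball_lift[OF \<psi> V(1) V(2)[OF m0] z(1) z(2) r m(2)] by metis
  then obtain G where G: "\<And>k. G k holomorphic_on ball 0 1" "\<And>k. G k 0 = z" "\<And>k. G k b \<notin> fatou_set f"
    "\<And>k y. y \<in> ball 0 1 \<Longrightarrow> iterate_finite f (m k) (G k y) \<and> (f ^^ m k) (G k y) \<notin> postsingular_set f"
    by metis
  obtain p q where pq: "p \<in> exceptional_set" "q \<in> exceptional_set" "p \<noteq> q"
    using exceptional_set_two_points by metis
  \<comment> \<open>Time \<open>i = 0\<close> yields the values omitted by the lifts
    \<open>G k\<close> themselves; later times control the orbits of points in their images.\<close>
  have omit: "(f ^^ i) (G k y) \<notin> exceptional_set" if "y \<in> ball 0 1" "i < m k" for i k y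
    using iterate_avoids_exceptional_set[of "m k" "G k y" i] G(4)[OF that(1)] that(2) by blast
  have "G k y \<noteq> p \<and> G k y \<noteq> q" if "y \<in> ball 0 1" for k y
    using omit[OF that m0[of k]] pq by auto
  moreover have "norm (G k 0) \<le> norm z" for k using G(2) by simp
  ultimately obtain g e where g: "g holomorphic_on ball 0 1" and e: "strict_mono (e :: nat \<Rightarrow> nat)"
    and lim: "\<And>K. \<lbrakk>compact K; K \<subseteq> ball 0 1\<rbrakk> \<Longrightarrow> uniform_limit K (\<lambda>n. G (e n)) g sequentially"
    using Montel_omitted_bounded_at_centre[of 1 p q G 0 "norm z", OF zero_less_one pq(3) G(1)] by metis
  have ptw: "(\<lambda>n. G (e n) y) \<longlonglongrightarrow> g y" if "y \<in> ball 0 1" for y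
    using tendsto_uniform_limitI[OF lim[of "{y}"]] that by auto
  have "(\<lambda>n. G (e n) 0) \<longlonglongrightarrow> g 0" by (rule ptw) simp
  then have "g 0 = z" using G(2) LIMSEQ_unique[OF _ tendsto_const] by auto
  \<comment> \<open>The Julia set in the plane is closed, so it contains the limit of the points
    \<open>G (e n) b\<close>.\<close>
  moreover have gb: "g b \<in> - fatou_set f"
    by (rule closed_sequentially[OF _ _ ptw[OF \<psi>(3)]]) (use open_fatou_set G(3) in auto)
  ultimately have "g 0 \<noteq> g b" using z(1) by auto
  then have "\<not> g constant_on ball 0 1" using \<psi>(3) unfolding constant_on_def
    by (metis centre_in_ball zero_less_one)
  then obtain c N where c: "c > 0" "\<And>n. n \<ge> N \<Longrightarrow> ball (g b) c \<subseteq> G (e n) ` ball 0 1"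
    using Hurwitz_ball_subset_image[of "ball 0 1" "\<lambda>n. G (e n)" g b] G(1) g lim \<psi>(3) by (metis connected_ball open_ball)
  have orbit: "iterate_finite f n v \<and> (f ^^ n) v \<notin> exceptional_set" if "v \<in> ball (g b) c" for n v
  proof -
    \<comment> \<open>This index is at least \<open>N\<close>, so the image of \<open>G k\<close>
      covers the disc about \<open>g b\<close>, and at least \<open>n\<close>, so
      \<open>omit\<close> reaches time \<open>n\<close>. The disc itself does not depend on
      \<open>n\<close>.\<close>
    define k where "k = e (max n N)"
    have "n < m k" using m(1)[of k] seq_suble[OF e, of "max n N"] by (simp add: k_def)
    moreover have "v \<in> G k ` ball 0 1" unfolding k_def by (rule subsetD[OF c(2) that]) simp
    then obtain y where y: "y \<in> ball 0 1" "v = G k y" by blast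
    ultimately show ?thesis using omit[OF y(1), of n k] G(4)[OF y(1), of k] iterate_finite_mono[of f "m k" v n] by auto
  qed
  have "g b \<in> fatou_set f"
    by (rule fatou_setI_omitting_two_values[OF c(1) pq(3)]) (use orbit pq in blast)+
  then show False using gb by blast
qed

end

section \<open>Diameters and distances to the boundary\<close>

lemma le_ediameter: "x \<in> S \<Longrightarrow> y \<in> S \<Longrightarrow> ennreal (dist x y) \<le> ediameter S"
  unfolding ediameter_def by (intro SUP_upper2[of x] SUP_upper2[of y]) auto

theorem corollaryC:
  fixes f :: "complex \<Rightarrow> complex" and U :: "complex set" and V :: "nat \<Rightarrow> complex set"
  assumes "topologically_hyperbolic f"
    and "fatou_component f U"
    and "\<And>n. fatou_component f (V n)"
    and "\<And>n. (f ^^ n) ` U \<subseteq> V n"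
    and "\<And>n. n > 0 \<Longrightarrow> V n \<inter> postsingular_set f = {}"
  shows "(\<forall>K. compact K \<and> K \<subseteq> U \<longrightarrow>
            (\<forall>z\<in>K. \<forall>r>0. \<exists>n0. \<forall>n\<ge>n0. ball ((f ^^ n) z) r \<subseteq> V n))
       \<and> ((\<lambda>n. ediameter (V n)) \<longlonglongrightarrow> \<infinity>)
       \<and> (\<forall>z\<in>U. filterlim (\<lambda>n. infdist ((f ^^ n) z) (frontier (V n))) at_top sequentially)"
proof -
  interpret topologically_hyperbolic_map f using assms(1) by unfold_locales
  have V: "V n \<in> components (fatou_set f)" for n using assms(3) by (simp add: fatou_component_def)
  have U: "U \<in> components (fatou_set f)" using assms(2) by (simp add: fatou_component_def)
  have balls: "\<exists>n0. \<forall>n\<ge>n0. ball ((f ^^ n) z) r \<subseteq> V n" if "z \<in> U" "r > 0" for z r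
    by (rule eventually_large_ball_subset_component[OF V assms(5)])
       (use that in_components_subset[OF U] assms(4) in auto)
  have diam: "(\<lambda>n. ediameter (V n)) \<longlonglongrightarrow> \<infinity>"
  proof -
    obtain z where z: "z \<in> U" using in_components_nonempty[OF U] by blast
    have "\<forall>\<^sub>F n in sequentially. ennreal M < ediameter (V n)" if "M \<ge> 0" for M
    proof -
      \<comment> \<open>Radius \<open>M + 2\<close> leaves room for a point at distance
        \<open>M + 1\<close> from the centre, which makes the inequality strict.\<close>
      obtain n0 where n0: "\<And>n. n \<ge> n0 \<Longrightarrow> ball ((f ^^ n) z) (M + 2) \<subseteq> V n"
        using balls[OF z, of "M + 2"] \<open>M \<ge> 0\<close> by auto
      have "ennreal M < ediameter (V n)" if "n \<ge> n0" for n
      proof -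
        define x where "x = (f ^^ n) z"
        have "x \<in> V n" "x + of_real (M + 1) \<in> V n" using n0[OF that] \<open>M \<ge> 0\<close>
          by (auto simp: x_def dist_norm subset_eq simp del: of_real_add)
        then have "ennreal (dist x (x + of_real (M + 1))) \<le> ediameter (V n)" by (rule le_ediameter)
        moreover have "dist x (x + of_real (M + 1)) = M + 1" using \<open>M \<ge> 0\<close> by (simp add: dist_norm del: of_real_add)
        moreover have "ennreal M < ennreal (M + 1)" using \<open>M \<ge> 0\<close> by (simp add: ennreal_lessI)
        ultimately show ?thesis by (metis order_less_le_trans)
      qed
      then show ?thesis by (auto simp: eventually_sequentially)
    qed
    then show ?thesis unfolding infinity_ennreal_def tendsto_top_iff_ennreal by blast
  qed
  have "filterlim (\<lambda>n. infdist ((f ^^ n) z) (frontier (V n))) at_top sequentially" if z: "z \<in> U" for z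
    unfolding filterlim_at_top
  proof
    fix M :: real
    obtain n0 where n0: "\<And>n. n \<ge> n0 \<Longrightarrow> ball ((f ^^ n) z) (max M 1) \<subseteq> V n"
        using balls[OF z, of "max M 1"] by (metis less_max_iff_disj zero_less_one)
    have "M \<le> infdist ((f ^^ n) z) (frontier (V n))" if n: "n \<ge> n0" for n
    proof -
      \<comment> \<open>\<open>infdist\<close> to the empty set is 0, so the frontier must be shown
        nonempty. \<open>setdist\<close> with an empty set is 0 as well, hence its positivity yields
        a Julia point in the plane.\<close>
      have "fatou_set f \<noteq> UNIV" using setdist_postsingular_julia_pos by auto
      then have "frontier (V n) \<noteq> {}"
        using in_components_nonempty[OF V] in_components_subset[OF V] by (auto simp: frontier_eq_empty)
      moreover have "open (V n)" using V open_components[OF open_fatou_set] by blast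
      then have "frontier (V n) \<inter> V n = {}" by (simp add: frontier_disjoint_eq)
      then have "M \<le> dist ((f ^^ n) z) y" if "y \<in> frontier (V n)" for y
        using n0[OF n] that by (force simp: not_less)
      ultimately show ?thesis by (simp add: infdist_notempty cINF_greatest)
    qed
    then show "\<forall>\<^sub>F n in sequentially. M \<le> infdist ((f ^^ n) z) (frontier (V n))"
      by (auto simp: eventually_sequentially)
  qed
  then show ?thesis using balls diam by blast
qed

end
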